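(* Let $L=\mathbb{Q}(\sqrt m,\sqrt n)$ be a biquadratic extension of $\mathbb{Q}$ with $m,n$ square-free and $m\equiv n\equiv1\pmod 4$. Let $d=\gcd(m,n)$, $k=\frac{mn}{d^2}$, and let $H_1,H_2,H_3$ be the non-classical Hopf-Galois structures on $L/\mathbb{Q}$ corresponding to $\sqrt m,\sqrt n,\sqrt k$ respectively. For $i\in\{1,2,3\}$, $\mathcal{O}_L$ is $\mathfrak{A}_{H_i}$-free if and only if there exist integers $x,y\in\mathbb{Z}$ such that at least one of the following two equations (one for each sign) is satisfied: 1. $x^2+my^2=\pm2d$, if $i=1$. 2. $x^2+ny^2=\pm2d$, if $i=2$. 3. $x^2+ky^2=\pm2\frac nd$, if $i=3$. In that case, a generator of $\mathcal{O}_L$ as $\mathfrak{A}_{H_i}$-module is as follows: - if $i=1$: $\beta=\frac12\left(\frac{my-x}{2d}-\epsilon\right)\gamma_1+\frac{1-y}{2}\gamma_2+\frac{x-my}{2d}\gamma_3+y\gamma_4$, where $\epsilon\in\{0,1\}$ is the residue of $\frac{x-my}{2d}$ modulo $2$; - if $i=2$: $\beta=\frac14\left(\frac{my-x}{d}-\epsilon\right)\gamma_1+\frac{x-yd}{2d}\gamma_2+\frac{d-my}{2d}\gamma_3+y\gamma_4$, where $\epsilon\in\{0,1,2,3\}$ is the residue of $\frac{my-x}{d}$ modulo $4$; - if $i=3$: $\beta=\frac14\left(\frac{k-x}{n/d}-y+\epsilon\right)\gamma_1+\frac{y-1}{2}\gamma_2+\frac{x-k}{2n/d}\gamma_3+\gamma_4$,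 where $\epsilon\in\{1,-1\}$ satisfies $\epsilon\equiv-\left(\frac{k-x}{n/d}-y\right)\pmod 4$. Here $\gamma_1=1,\ \gamma_2=\frac{1+\sqrt m}{2},\ \gamma_3=\frac{1+\sqrt n}{2},\ \gamma_4=\left(\frac{1+\sqrt m}{2}\right)\left(\frac{1+\sqrt k}{2}\right)$.
   Context: $L=\mathbb{Q}(\sqrt m,\sqrt n)$ has Galois group $C_2\times C_2$; its quadratic subfields are $\mathbb{Q}(\sqrt m),\mathbb{Q}(\sqrt n),\mathbb{Q}(\sqrt k)$, with $\sqrt k=\sqrt m\sqrt n/d$ and $d=\gcd(m,n)>0$. Here $k\equiv1\pmod 4$ and $\{\gamma_1,\gamma_2,\gamma_3,\gamma_4\}$ is an integral basis of $L$. A Hopf-Galois structure on $L/\mathbb{Q}$ is a finite-dimensional cocommutative $\mathbb{Q}$-Hopf algebra $H$ with an action making $L$ a left $H$-module algebra such that $L\otimes_{\mathbb{Q}} H\to\mathrm{End}_{\mathbb{Q}}(L)$, $x\otimes h\mapsto(y\mapsto x(h\cdot y))$ is bijective. Besides the classical one $\mathbb{Q}[\mathrm{Gal}(L/\mathbb{Q})]$, there are exactly three, one for each $\zeta\in\{\sqrt m,\sqrt n,\sqrt k\}$. Explicitly, let $\tau$ generate $\mathrm{Gal}(L/\mathbb{Q}(\zeta))$ and let $\sigma\in\mathrm{Gal}(L/\mathbb{Q})\setminus\langle\tau\rangle$; since the action is faithful, the structure corresponding to $\zeta$ is identified, as an algebra acting on $L$, with the subalgebra of $\mathrm{End}_{\mathbb{Q}}(L)$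 having $\mathbb{Q}$-basis $\mathrm{id},\ \tau,\ \sigma+\sigma\tau,\ \zeta(\sigma-\sigma\tau)$. The associated order is $\mathfrak{A}_H=\{h\in H: h\cdot\mathcal{O}_L\subseteq\mathcal{O}_L\}$; "$\mathcal{O}_L$ is $\mathfrak{A}_H$-free" means free (of rank one) as $\mathfrak{A}_H$-module, and a generator is a $\beta\in\mathcal{O}_L$ such that $\mathfrak{A}_H\to\mathcal{O}_L$, $h\mapsto h\cdot\beta$, is bijective. *)

theory Defs
  imports
    Complex_Main
    "HOL-Algebra.Algebra"
    "HOL-Algebra.Algebraic_Closure_Type"
    "HOL-Computational_Algebra.Computational_Algebra"
    "HOL-Number_Theory.Cong"
begin

text \<open>All number fields are subfields of the complex numbers; the endomorphisms of such a
  field \<open>L\<close> are represented by functions that are \<^const>\<open>extensional\<close> on \<open>L\<close>, so that equality of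
  endomorphisms is equality of functions.\<close>

abbreviation complex_ring :: "complex ring" where
  "complex_ring \<equiv> ring_of_type_algebra"

definition rat_adjoin :: "complex set \<Rightarrow> complex set" where
  "rat_adjoin S = generate_field complex_ring (\<rat> \<union> S)"

definition Gal :: "complex set \<Rightarrow> complex set \<Rightarrow> (complex \<Rightarrow> complex) monoid" where
  "Gal L K = BijGroup L
     \<lparr>carrier := {s \<in> Bij L \<inter> ring_hom (complex_ring\<lparr>carrier := L\<rparr>) (complex_ring\<lparr>carrier := L\<rparr>).
                   \<forall>x\<in>K. s x = x}\<rparr>"

definition biquadratic :: "complex set \<Rightarrow> bool" where
  "biquadratic L \<longleftrightarrow>
     subfield L complex_ring \<and>
     {x \<in> L. \<forall>s \<in> carrier (Gal L \<rat>). s x = x} = \<rat> \<and>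
     Gal L \<rat> \<cong> integer_mod_group 2 \<times>\<times> integer_mod_group 2"

definition ring_of_integers :: "complex set \<Rightarrow> complex set" where
  "ring_of_integers L = {x \<in> L. algebraic_int x}"

text \<open>The \<open>\<rat>\<close>-span of \<open>id, \<tau>, \<sigma> + \<sigma>\<tau>, \<zeta>(\<sigma> - \<sigma>\<tau>)\<close> in the \<open>\<rat>\<close>-linear endomorphisms of \<open>L\<close>.\<close>

definition HG_span :: "complex set \<Rightarrow> complex \<Rightarrow> (complex \<Rightarrow> complex) \<Rightarrow> (complex \<Rightarrow> complex)
    \<Rightarrow> (complex \<Rightarrow> complex) set" where
  "HG_span L \<zeta> \<tau> \<sigma> =
     {(\<lambda>x\<in>L. of_rat a * x + of_rat b * \<tau> x + of_rat c * (\<sigma> x + \<sigma> (\<tau> x))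
              + of_rat e * (\<zeta> * (\<sigma> x - \<sigma> (\<tau> x)))) | a b c e. True}"

text \<open>\<open>H\<close> is the non-classical Hopf-Galois structure on \<open>L/\<rat>\<close> corresponding to \<open>\<zeta>\<close>, as an algebra of
  endomorphisms of \<open>L\<close>: the action is faithful, and the coalgebra structure plays no role for
  associated orders and freeness. The span does not depend on the choice of \<open>\<sigma>\<close>: the other choice \<open>\<sigma>\<tau>\<close> only
  changes the sign of the last basis element.\<close>

definition nonclassical_HG :: "complex set \<Rightarrow> complex \<Rightarrow> (complex \<Rightarrow> complex) set \<Rightarrow> bool" where
  "nonclassical_HG L \<zeta> H \<longleftrightarrow>
     (\<exists>\<tau> \<sigma>. \<tau> \<in> carrier (Gal L (rat_adjoin {\<zeta>})) \<and>
            generate (Gal L \<rat>) {\<tau>} = carrier (Gal L (rat_adjoin {\<zeta>})) \<and>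
            \<sigma> \<in> carrier (Gal L \<rat>) - generate (Gal L \<rat>) {\<tau>} \<and>
            H = HG_span L \<zeta> \<tau> \<sigma>)"

definition associated_order :: "complex set \<Rightarrow> (complex \<Rightarrow> complex) set \<Rightarrow> (complex \<Rightarrow> complex) set" where
  "associated_order L H = {h \<in> H. h ` ring_of_integers L \<subseteq> ring_of_integers L}"

text \<open>\<open>A\<close> acts on \<open>M\<close> by evaluation, so \<open>h \<mapsto> h \<beta>\<close> is automatically a homomorphism of left
  \<open>A\<close>-modules; it is bijective iff \<open>{\<beta>}\<close> is an \<open>A\<close>-basis of \<open>M\<close>.\<close>

definition free_generator :: "(complex \<Rightarrow> complex) set \<Rightarrow> complex set \<Rightarrow> complex \<Rightarrow> bool" where
  "free_generator A M \<beta> \<longleftrightarrow> \<beta> \<in> M \<and> bij_betw (\<lambda>h. h \<beta>) A M"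

definition free_of_rank_one :: "(complex \<Rightarrow> complex) set \<Rightarrow> complex set \<Rightarrow> bool" where
  "free_of_rank_one A M \<longleftrightarrow> (\<exists>\<beta>. free_generator A M \<beta>)"

end

(* Put c1 = n/d, c2 = m/d, c3 = d. These are pairwise coprime and congruent modulo 4 to a common
   sign e, and r1 = sqrt m, r2 = sqrt n, r3 = sqrt k satisfy ri * rj = ck * rk cyclically. In these
   coordinates (u0 + u1 r1 + u2 r2 + u3 r3) / 4 is integral iff the ui have the same parity and
   4 divides u0 + e (u1 + u2 + u3), so the three cases are cyclic permutations of one another.

   The structure attached to r1 acts on the coordinates by
   (p u0, q u1, r u2 - s c2 u3, r u3 + s c3 u2); its associated order consists of the integral
   (p, q, r, s) with p = r + s (mod 2) and p + q + 2r = 0 (mod 4). The map h |-> h beta has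
   determinant u0 u1 (c3 u2^2 + c2 u3^2) in these coordinates, so that it is onto the integral
   lattice iff u0, u1 = +-1 and c3 u2^2 + c2 u3^2 = +-2. Multiplying by c3 turns the last condition
   into x^2 + m y^2 = +-2 d with x = c3 u2, y = u3. *)

theory Submission
  imports Defs "Jordan_Normal_Form.Char_Poly"
begin

subsection \<open>Algebraic integers\<close>

text \<open>The structure attached to r1 preserves the lines Q and Q r1 and the plane spanned by r2
  and r3. On the plane it acts through r + s w, where w sends r2 to c3 r3 and r3 to -c2 r2, so that
  w^2 = -c2 c3. As an algebra it is therefore Q x Q x Q(sqrt(-c2 c3)), the plane is one-dimensional
  over the last factor, and c3 u2^2 + c2 u3^2 is its norm form up to scaling. This is why the values
  of x^2 + m y^2, the norms from Q(sqrt(-m)), decide freeness for i = 1. The constant 2 is a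
  quotient of indices: inside Z^4 the lattice of integral coordinates has index 16 and the
  associated order index 8, so a bijective h |-> h beta must have determinant +-2. The proof does
  not count indices; it solves the linear system for a few well-chosen lattice vectors. The ring of
  integers is defined through \<open>algebraic_int\<close> alone, so its lattice description has to
  be derived: this takes closure of algebraic integers under sums and products, and traces and norms
  along the automorphisms.\<close>

lemma algebraic_int_eigenvalue:
  fixes v :: "nat \<Rightarrow> complex"
  assumes A: "(A :: int mat) \<in> carrier_mat n n"
    and ev: "\<And>i. i < n \<Longrightarrow> z * v i = (\<Sum>j<n. of_int (A $$ (i, j)) * v j)"
    and nz: "i0 < n" "v i0 \<noteq> 0"
  shows "algebraic_int z"
proof -
  let ?B = "map_mat of_int A :: complex mat"
  have B: "?B \<in> carrier_mat n n" using A by simp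
  have "?B *\<^sub>v vec n v = z \<cdot>\<^sub>v vec n v"
    using A ev by (intro eq_vecI) (auto simp: scalar_prod_def lessThan_atLeast0)
  moreover have "vec n v \<noteq> 0\<^sub>v n"
    using nz by (metis index_vec index_zero_vec(1))
  ultimately have "eigenvalue ?B z"
    unfolding eigenvalue_def eigenvector_def using B A by (intro exI[of _ "vec n v"]) auto
  hence "poly (char_poly ?B) z = 0"
    using eigenvalue_root_char_poly[OF B] by simp
  hence "poly (of_int_poly (char_poly A)) z = 0"
    by (simp add: of_int_hom.char_poly_hom[OF A])
  moreover have "lead_coeff (char_poly A) = 1"
    using degree_monic_char_poly[OF A] by auto
  ultimately show ?thesis
    unfolding algebraic_int_altdef_ipoly by blast
qed

text \<open>The determinant trick: multiplication by z is given by an integer matrix with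
  eigenvector v, and the characteristic polynomial of that matrix is monic with integer
  coefficients. An arbitrary finite index set allows pairs of exponents as indices.\<close>

lemma algebraic_int_finite_module:
  fixes v :: "'i \<Rightarrow> complex"
  assumes fin: "finite I" and nz: "i0 \<in> I" "v i0 \<noteq> 0"
    and ev: "\<And>i. i \<in> I \<Longrightarrow> \<exists>c :: 'i \<Rightarrow> int. z * v i = (\<Sum>j\<in>I. of_int (c j) * v j)"
  shows "algebraic_int z"
proof -
  obtain f where f: "bij_betw f {0..<card I} I"
    using ex_bij_betw_nat_finite[OF fin] by blast
  obtain c :: "'i \<Rightarrow> 'i \<Rightarrow> int" where c: "\<And>i. i \<in> I \<Longrightarrow> z * v i = (\<Sum>j\<in>I. of_int (c i j) * v j)"
    using ev by metis
  define A where "A = mat (card I) (card I) (\<lambda>(i, j). c (f i) (f j))"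
  obtain k where k: "k < card I" "f k = i0"
    using f nz(1) by (metis atLeastLessThan_iff bij_betwE bij_betw_imp_surj_on imageE)
  show ?thesis
  proof (rule algebraic_int_eigenvalue[where v = "v \<circ> f" and A = A and ?i0.0 = k])
    show "A \<in> carrier_mat (card I) (card I)" by (simp add: A_def)
    show "k < card I" "(v \<circ> f) k \<noteq> 0" using k nz by auto
    fix i assume i: "i < card I"
    have "z * v (f i) = (\<Sum>j\<in>I. of_int (c (f i) j) * v j)"
      using c i f by (metis atLeastLessThan_iff bij_betwE le0)
    also have "\<dots> = (\<Sum>j\<in>{0..<card I}. of_int (c (f i) (f j)) * v (f j))"
      by (rule sum.reindex_bij_betw[OF f, symmetric])
    also have "\<dots> = (\<Sum>j<card I. of_int (A $$ (i, j)) * v (f j))"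
      using i by (intro sum.cong) (auto simp: A_def)
    finally show "z * (v \<circ> f) i = (\<Sum>j<card I. of_int (A $$ (i, j)) * (v \<circ> f) j)" by simp
  qed
qed

text \<open>The bound \<open>a > 0\<close> holds since a monic constant has no root; it ensures that
  1 = x^0 is among the powers below a.\<close>

lemma algebraic_int_power_relation:
  assumes "algebraic_int (x :: complex)"
  obtains a and c :: "nat \<Rightarrow> int" where "a > 0" "x ^ a = (\<Sum>i<a. of_int (c i) * x ^ i)"
proof -
  obtain p :: "int poly" where p: "poly (of_int_poly p) x = 0" "lead_coeff p = 1"
    using assms by (auto simp: algebraic_int_altdef_ipoly)
  have "degree p > 0"
  proof (rule ccontr)
    assume "\<not> degree p > 0"
    then obtain a where "p = [:a:]" by (metis degree_eq_zeroE gr0I)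
    with p show False by simp
  qed
  moreover have "0 = (\<Sum>i\<le>degree p. of_int (coeff p i) * x ^ i)"
    using p by (simp add: poly_altdef)
  hence "x ^ degree p = (\<Sum>i<degree p. of_int (- coeff p i) * x ^ i)"
    using p(2) by (simp add: lessThan_Suc_atMost[symmetric] sum_negf eq_neg_iff_add_eq_0 add.commute)
  ultimately show ?thesis by (rule that)
qed

text \<open>The Z-span M of the monomials x^i y^j with i < a, j < b is stable under multiplication
  by x and by y: a monomial that leaves the range is brought back by the power relation. Hence M is
  stable under x + y and x y, and it contains 1.\<close>

lemma algebraic_int_plus_times:
  assumes "algebraic_int (x :: complex)" "algebraic_int y"
  shows "algebraic_int (x + y)" "algebraic_int (x * y)"
proof -
  obtain a c where a: "a > 0" "x ^ a = (\<Sum>i<a. of_int (c i) * x ^ i)"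
    using assms(1) by (rule algebraic_int_power_relation)
  obtain b d where b: "b > 0" "y ^ b = (\<Sum>i<b. of_int (d i) * y ^ i)"
    using assms(2) by (rule algebraic_int_power_relation)
  define I where "I = {..<a} \<times> {..<b}"
  define v where "v = (\<lambda>(i, j). x ^ i * y ^ j)"
  define M where "M = {\<Sum>k\<in>I. of_int (f k) * v k | f :: nat \<times> nat \<Rightarrow> int. True}"
  have fin: "finite I" by (simp add: I_def)
  have M0: "0 \<in> M"
    unfolding M_def by (intro CollectI exI[of _ "\<lambda>_. 0"]) auto
  have Madd: "s + t \<in> M" if "s \<in> M" "t \<in> M" for s t
  proof -
    obtain f g where "s = (\<Sum>k\<in>I. of_int (f k) * v k)" "t = (\<Sum>k\<in>I. of_int (g k) * v k)"
      using \<open>s \<in> M\<close> \<open>t \<in> M\<close> unfolding M_def by blast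
    thus ?thesis unfolding M_def
      by (intro CollectI exI[of _ "\<lambda>k. f k + g k"]) (simp add: sum.distrib algebra_simps)
  qed
  have Mmul: "of_int l * s \<in> M" if "s \<in> M" for s l
  proof -
    obtain f where "s = (\<Sum>k\<in>I. of_int (f k) * v k)"
      using \<open>s \<in> M\<close> unfolding M_def by blast
    thus ?thesis unfolding M_def
      by (intro CollectI exI[of _ "\<lambda>k. l * f k"]) (simp add: sum_distrib_left algebra_simps)
  qed
  have Msum: "(\<Sum>k\<in>K. g k) \<in> M" if "\<And>k. k \<in> K \<Longrightarrow> g k \<in> M" for g :: "'k \<Rightarrow> complex" and K
    using that by (induction K rule: infinite_finite_induct) (auto simp: M0 Madd)
  have vM: "x ^ i * y ^ j \<in> M" if "i < a" "j < b" for i j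
  proof -
    have "(\<Sum>k\<in>I. of_int (if k = (i, j) then 1 else 0) * v k) = (\<Sum>k\<in>I. if k = (i, j) then v k else 0)"
      by (rule sum.cong) auto
    also have "\<dots> = x ^ i * y ^ j" using fin that by (simp add: sum.delta I_def v_def)
    finally show ?thesis unfolding M_def
      by (intro CollectI exI[of _ "\<lambda>k. if k = (i, j) then 1 else 0"]) simp
  qed
  have xM: "x * s \<in> M" if "s \<in> M" for s
  proof -
    obtain f where s: "s = (\<Sum>k\<in>I. of_int (f k) * v k)"
      using \<open>s \<in> M\<close> unfolding M_def by blast
    have "x * (x ^ i * y ^ j) \<in> M" if "i < a" "j < b" for i j
    proof (cases "Suc i < a")
      case True
      thus ?thesis using vM[of "Suc i" j] that by (simp add: mult.assoc)
    next
      case False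
      with that have "Suc i = a" by simp
      hence "x * (x ^ i * y ^ j) = x ^ a * y ^ j" by (metis mult.assoc power_Suc)
      also have "\<dots> = (\<Sum>k<a. of_int (c k) * (x ^ k * y ^ j))"
        by (simp add: a(2) sum_distrib_right mult.assoc)
      also have "\<dots> \<in> M" using that by (auto intro!: Msum Mmul vM)
      finally show ?thesis .
    qed
    hence "(\<Sum>k\<in>I. of_int (f k) * (x * v k)) \<in> M"
      by (auto intro!: Msum Mmul simp: I_def v_def)
    thus ?thesis by (simp add: s sum_distrib_left algebra_simps)
  qed
  have yM: "y * s \<in> M" if "s \<in> M" for s
  proof -
    obtain f where s: "s = (\<Sum>k\<in>I. of_int (f k) * v k)"
      using \<open>s \<in> M\<close> unfolding M_def by blast
    have "y * (x ^ i * y ^ j) \<in> M" if "i < a" "j < b" for i j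
    proof (cases "Suc j < b")
      case True
      thus ?thesis using vM[of i "Suc j"] that by (simp add: mult.left_commute)
    next
      case False
      with that have "Suc j = b" by simp
      hence "y * (x ^ i * y ^ j) = x ^ i * y ^ b" by (metis mult.left_commute power_Suc)
      also have "\<dots> = (\<Sum>k<b. of_int (d k) * (x ^ i * y ^ k))"
        by (simp add: b(2) sum_distrib_left algebra_simps)
      also have "\<dots> \<in> M" using that by (auto intro!: Msum Mmul vM)
      finally show ?thesis .
    qed
    hence "(\<Sum>k\<in>I. of_int (f k) * (y * v k)) \<in> M"
      by (auto intro!: Msum Mmul simp: I_def v_def)
    thus ?thesis by (simp add: s sum_distrib_left algebra_simps)
  qed
  have *: "algebraic_int z" if "\<And>s. s \<in> M \<Longrightarrow> z * s \<in> M" for z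
  proof (rule algebraic_int_finite_module[OF fin, where v = v and ?i0.0 = "(0, 0)"])
    show "(0, 0) \<in> I" "v (0, 0) \<noteq> 0" using a b by (auto simp: I_def v_def)
    fix i assume "i \<in> I"
    hence "z * v i \<in> M" using that vM by (auto simp: I_def v_def)
    thus "\<exists>f :: nat \<times> nat \<Rightarrow> int. z * v i = (\<Sum>j\<in>I. of_int (f j) * v j)"
      unfolding M_def by blast
  qed
  show "algebraic_int (x + y)"
    by (rule *) (auto simp: distrib_right intro!: Madd xM yM)
  show "algebraic_int (x * y)"
    by (rule *) (auto simp: mult.assoc intro!: xM yM)
qed

lemma algebraic_int_diff:
  "algebraic_int (x :: complex) \<Longrightarrow> algebraic_int y \<Longrightarrow> algebraic_int (x - y)"
  using algebraic_int_plus_times(1)[of x "- y"] by simp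

lemma algebraic_int_of_rat:
  assumes "algebraic_int (of_rat a :: complex)"
  shows "\<exists>u :: int. a = of_int u"
proof -
  have "(of_rat a :: complex) \<in> \<int>"
    using assms by (intro rational_algebraic_int_is_int) auto
  then obtain u :: int where "of_rat a = (of_int u :: complex)" by (auto elim: Ints_cases)
  hence "of_rat a = (of_rat (of_int u) :: complex)" by simp
  thus ?thesis using of_rat_eq_iff by blast
qed

subsection \<open>The lattice of integral coordinates\<close>

definition lat :: "int \<Rightarrow> int \<Rightarrow> int \<Rightarrow> int \<Rightarrow> int \<Rightarrow> bool" where
  "lat e u0 u1 u2 u3 \<longleftrightarrow> even (u1 - u0) \<and> even (u2 - u0) \<and> even (u3 - u0) \<and> 4 dvd u0 + e * (u1 + u2 + u3)"

text \<open>Image of the associated order under \<open>h \<mapsto> (p, q, r, s)\<close>.\<close>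

definition ord_cond :: "int \<Rightarrow> int \<Rightarrow> int \<Rightarrow> int \<Rightarrow> bool" where
  "ord_cond p q r s \<longleftrightarrow> even (p - r - s) \<and> 4 dvd p + q + 2 * r"

lemma even_if_four_dvd_double: "4 dvd 2 * x \<Longrightarrow> even x" for x :: int
  by presburger

lemma lat_rotate: "lat e u0 u1 u2 u3 \<longleftrightarrow> lat e u0 u2 u3 u1"
  by (auto simp: lat_def algebra_simps)

text \<open>The choice \<open>c = m / d\<close> is the congruence that the integral basis \<open>\<gamma>\<^sub>1, \<dots>, \<gamma>\<^sub>4\<close> gives directly.\<close>

lemma lat_alt:
  assumes "e = 1 \<or> e = - 1" "4 dvd c - e"
  shows "lat e u0 u1 u2 u3 \<longleftrightarrow>
    even (u1 - u0) \<and> even (u2 - u0) \<and> even (u3 - u0) \<and> 4 dvd u0 - u1 - u2 + c * u3"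
proof -
  obtain x where c: "c = e + 4 * x" using assms(2) by (metis dvdE add.commute diff_eq_eq)
  have "4 dvd u0 + e * (u1 + u2 + u3) \<longleftrightarrow> 4 dvd u0 - u1 - u2 + c * u3"
    if u: "u1 = u0 + 2 * i" "u2 = u0 + 2 * j" for i j
  proof -
    have "4 dvd (u0 + e * (u1 + u2 + u3)) - (u0 - u1 - u2 + c * u3)"
      using assms(1)
    proof
      assume e: "e = 1"
      show ?thesis unfolding c u e by Groebner_Basis.algebra
    next
      assume e: "e = - 1"
      show ?thesis unfolding c u e by Groebner_Basis.algebra
    qed
    thus ?thesis by (metis dvd_add_right_iff diff_add_cancel)
  qed
  moreover have "even (a - u0) \<longleftrightarrow> (\<exists>i. a = u0 + 2 * i)" for a
    by presburger
  ultimately show ?thesis unfolding lat_def by metis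
qed

text \<open>Every congruence in the hypotheses is solved for one variable. What remains, for each
  sign e, is the divisibility by 2 or 4 of a polynomial in free integer parameters.\<close>

lemma lat_image:
  assumes e: "e = 1 \<or> e = - 1" and c: "4 dvd c2 - e" "4 dvd c3 - e"
    and o: "ord_cond p q r s" and u: "lat e u0 u1 u2 u3"
  shows "lat e (p * u0) (q * u1) (r * u2 - s * c2 * u3) (r * u3 + s * c3 * u2)"
proof -
  obtain x y where c: "c2 = e + 4 * x" "c3 = e + 4 * y"
    using c by (metis dvdE add.commute diff_eq_eq)
  obtain t where p: "p = r + s + 2 * t" using o unfolding ord_cond_def by (elim conjE dvdE) (simp add: algebra_simps)
  obtain z where q: "q = 4 * z - p - 2 * r" using o unfolding ord_cond_def by (elim conjE dvdE) (simp add: algebra_simps)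
  obtain i where u1: "u1 = u0 + 2 * i" using u unfolding lat_def by (elim conjE dvdE) (simp add: algebra_simps)
  obtain j where u2: "u2 = u0 + 2 * j" using u unfolding lat_def by (elim conjE dvdE) (simp add: algebra_simps)
  obtain w where w: "u0 + e * (u1 + u2 + u3) = 4 * w" using u unfolding lat_def by (elim conjE dvdE)
  show ?thesis using e
  proof
    assume e: "e = 1"
    have u3: "u3 = 4 * w - u0 - u1 - u2" using w e by simp
    show ?thesis unfolding lat_def c e u3 p q u1 u2 by (intro conjI; Groebner_Basis.algebra)
  next
    assume e: "e = - 1"
    have u3: "u3 = u0 - u1 - u2 - 4 * w" using w e by simp
    show ?thesis unfolding lat_def c e u3 p q u1 u2 by (intro conjI; Groebner_Basis.algebra)
  qed
qed


text \<open>A few test vectors suffice. The vectors (4,0,0,0), (2,2,0,0), (2,0,2,0), (2,0,0,2) show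
  that p, q, r, s c3 and s c2 are integers; (2,0,2,0) also gives the parity condition, and (1,e,e,e)
  the condition modulo 4.\<close>

lemma ord_cond_if_lat_image:
  fixes p q r s :: rat
  assumes e: "e = 1 \<or> e = - 1" and c: "4 dvd c2 - e" "4 dvd c3 - e" "coprime c2 c3"
    and img: "\<And>u0 u1 u2 u3. lat e u0 u1 u2 u3 \<Longrightarrow> \<exists>v0 v1 v2 v3. lat e v0 v1 v2 v3 \<and>
      of_int v0 = p * of_int u0 \<and> of_int v1 = q * of_int u1 \<and>
      of_int v2 = r * of_int u2 - s * of_int c2 * of_int u3 \<and>
      of_int v3 = r * of_int u3 + s * of_int c3 * of_int u2"
  shows "\<exists>P Q R S. p = of_int P \<and> q = of_int Q \<and> r = of_int R \<and> s = of_int S \<and> ord_cond P Q R S"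
proof -
  have odd: "odd c2" "odd c3" using e c(1,2) by presburger+
  have int_div: "\<exists>z. x = of_int z \<and> v = k * z" if "k dvd v" "k \<noteq> 0" "of_int v = x * of_int k" for x :: rat and v k
    using that by (auto elim!: dvdE)
  have "lat e 4 0 0 0" by (simp add: lat_def)
  from img[OF this] obtain v where "lat e v 0 0 0" "of_int v = p * of_int 4" by auto
  hence "\<exists>P. p = of_int P" using int_div[of 4 v p] by (auto simp: lat_def)
  then obtain P where P: "p = of_int P" by blast
  have img': "\<exists>v1 v2 v3. lat e (P * u0) v1 v2 v3 \<and> of_int v1 = q * of_int u1 \<and>
      of_int v2 = r * of_int u2 - s * of_int c2 * of_int u3 \<and>
      of_int v3 = r * of_int u3 + s * of_int c3 * of_int u2" if u: "lat e u0 u1 u2 u3" for u0 u1 u2 u3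
    using img[OF u] unfolding P by (metis of_int_eq_iff of_int_mult)
  have "lat e 2 2 0 0" using e by (auto simp: lat_def)
  from img'[OF this] obtain v where "lat e (P * 2) v 0 0" "of_int v = q * of_int 2"
    by auto
  hence "\<exists>Q. q = of_int Q" using int_div[of 2 v q] by (auto simp: lat_def)
  then obtain Q where Q: "q = of_int Q" by blast
  have "lat e 2 0 2 0" using e by (auto simp: lat_def)
  from img'[OF this] obtain v w where vw: "lat e (P * 2) 0 v w" "of_int v = r * of_int 2"
      "of_int w = s * of_int c3 * of_int 2"
    by auto
  from vw obtain R where R: "r = of_int R" "v = 2 * R" using int_div[of 2 v r] by (auto simp: lat_def)
  from vw obtain A where A: "s * of_int c3 = of_int A" "w = 2 * A"
    using int_div[of 2 w "s * of_int c3"] by (auto simp: lat_def)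
  have "lat e 2 0 0 2" using e by (auto simp: lat_def)
  from img'[OF this] obtain v' w' where "lat e (P * 2) 0 v' w'" "of_int v' = - (s * of_int c2) * of_int 2"
    by auto
  then obtain B where B: "- (s * of_int c2) = of_int B"
    using int_div[of 2 v' "- (s * of_int c2)"] by (auto simp: lat_def)
  \<comment> \<open>Both s c2 and s c3 are integers, so a Bezout relation between c2 and c3 makes s
    an integer.\<close>
  obtain x y where xy: "x * c2 + y * c3 = 1" using c(3) by (metis bezout_int coprime_imp_gcd_eq_1)
  have "s = s * of_int (x * c2 + y * c3)" by (simp add: xy)
  also have "\<dots> = of_int x * (s * of_int c2) + of_int y * (s * of_int c3)"
    by (simp add: algebra_simps)
  also have "s * of_int c2 = of_int (- B)" using B by simp
  also have "of_int x * of_int (- B) + of_int y * (s * of_int c3) = (of_int (y * A - x * B) :: rat)"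
    by (simp add: A)
  finally obtain S where S: "s = of_int S" by blast
  have AS: "A = S * c3" using A(1) unfolding S by (metis of_int_eq_iff of_int_mult)
  have "4 dvd P * 2 + e * (2 * R + 2 * (S * c3))" using vw(1) by (simp add: lat_def R A(2) AS)
  hence "4 dvd 2 * (P + e * (R + S * c3))" by (simp add: algebra_simps)
  hence "even (P + e * (R + S * c3))" by (rule even_if_four_dvd_double)
  hence 1: "even (P - R - S)" using e odd by auto
  \<comment> \<open>Since e^2 = 1, the sign e cancels in the lattice condition of the image, leaving
    P + Q + 2 R + S (c3 - c2), whose last term is 0 modulo 4.\<close>
  have "lat e 1 e e e" using e by (auto simp: lat_def)
  from img'[OF this] obtain v1 v2 v3 where v: "lat e (P * 1) v1 v2 v3" "of_int v1 = q * of_int e"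
      "of_int v2 = r * of_int e - s * of_int c2 * of_int e"
      "of_int v3 = r * of_int e + s * of_int c3 * of_int e" by blast
  have "v1 = Q * e" "v2 = R * e - S * c2 * e" "v3 = R * e + S * c3 * e"
    using v(2-4) unfolding Q R S by (metis of_int_eq_iff of_int_mult of_int_add of_int_diff)+
  with v(1) have "lat e P (Q * e) (R * e - S * c2 * e) (R * e + S * c3 * e)" by simp
  hence "4 dvd P + Q + 2 * R + S * (c3 - c2)"
    using e by (auto simp: lat_def algebra_simps)
  moreover have "4 dvd S * (c3 - c2)" using c(1,2) by (metis dvd_diff dvd_mult diff_diff_eq2 diff_add_cancel)
  ultimately have "4 dvd P + Q + 2 * R" by (metis dvd_add_left_iff)
  with 1 have "ord_cond P Q R S" by (simp add: ord_cond_def)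
  thus ?thesis using P Q R S by blast
qed

text \<open>Cramer's rule for r and s with determinant D = +-2: the numerators are even because the
  u's are odd and v2, v3 have equal parity. The unknowns p and q come from u0 and u1 being their own
  inverses. That the solution lies in the order is then deduced from the lattice condition on
  v.\<close>

lemma lat_solve:
  assumes e: "e = 1 \<or> e = - 1" and c: "4 dvd c2 - e" "4 dvd c3 - e"
    and u: "lat e u0 u1 u2 u3" "\<bar>u0\<bar> = 1" "\<bar>u1\<bar> = 1" "\<bar>c3 * u2\<^sup>2 + c2 * u3\<^sup>2\<bar> = 2"
    and v: "lat e v0 v1 v2 v3"
  shows "\<exists>p q r s. ord_cond p q r s \<and> v0 = p * u0 \<and> v1 = q * u1 \<and>
    v2 = r * u2 - s * c2 * u3 \<and> v3 = r * u3 + s * c3 * u2"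
proof -
  define D where "D = c3 * u2\<^sup>2 + c2 * u3\<^sup>2"
  have D: "D = 2 \<or> D = - 2" using u(4) unfolding D_def by linarith
  have D0: "D \<noteq> 0" using D by auto
  have odd: "odd c2" "odd c3" using e c(1,2) by presburger+
  have oddu: "odd u0" "odd u1" "odd u2" "odd u3"
    using u(1-3) unfolding lat_def by presburger+
  have par: "even (v2 - v3)" "even (v2 - v0)" "even (v1 - v0)" using v unfolding lat_def by presburger+
  have dvdD: "D dvd x" if "even x" for x using that D by auto
  have "D dvd c3 * u2 * v2 + c2 * u3 * v3" "D dvd u2 * v3 - u3 * v2"
    using odd oddu par by (auto intro!: dvdD)
  then obtain r s where r: "c3 * u2 * v2 + c2 * u3 * v3 = D * r" and s: "u2 * v3 - u3 * v2 = D * s"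
    by (auto elim!: dvdE)
  have "D * v2 = D * (r * u2 - s * c2 * u3)"
    using r s unfolding D_def by Groebner_Basis.algebra
  hence v2: "v2 = r * u2 - s * c2 * u3" using D0 by simp
  have "D * v3 = D * (r * u3 + s * c3 * u2)"
    using r s unfolding D_def by Groebner_Basis.algebra
  hence v3: "v3 = r * u3 + s * c3 * u2" using D0 by simp
  define p q where "p = v0 * u0" and "q = v1 * u1"
  have v01: "v0 = p * u0" "v1 = q * u1" using u(2,3) unfolding p_def q_def by (auto simp: abs_if split: if_splits)
  have "odd (c3 * u2)" using odd oddu by simp
  hence parity: "even (p - r - s)" "even (q - r + s)"
    using par oddu odd unfolding v01 v2 v3 by auto
  obtain x y where c: "c2 = e + 4 * x" "c3 = e + 4 * y"
    using c by (metis dvdE add.commute diff_eq_eq)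
  obtain t t' where tt: "p = r + s + 2 * t" "q = r - s + 2 * t'"
    using parity by (elim dvdE) (simp add: algebra_simps)
  obtain i where u1: "u1 = u0 + 2 * i" using u(1) unfolding lat_def by (elim conjE dvdE) (simp add: algebra_simps)
  obtain j where u2: "u2 = u0 + 2 * j" using u(1) unfolding lat_def by (elim conjE dvdE) (simp add: algebra_simps)
  obtain w where w: "u0 + e * (u1 + u2 + u3) = 4 * w" using u(1) unfolding lat_def by (elim conjE dvdE)
  \<comment> \<open>Modulo 4 the lattice condition on v becomes 2 (t u0 + e t' u1), so t + t' is
    even; and p + q + 2 r = 4 r + 2 (t + t').\<close>
  have "4 dvd (v0 + e * (v1 + v2 + v3)) - ((p - r - s) * u0 + e * (q - r + s) * u1)"
    using e
  proof
    assume e: "e = 1"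
    have u3: "u3 = 4 * w - u0 - u1 - u2" using w e by simp
    show ?thesis unfolding v01 v2 v3 c e u3 u1 u2 by Groebner_Basis.algebra
  next
    assume e: "e = - 1"
    have u3: "u3 = u0 - u1 - u2 - 4 * w" using w e by simp
    show ?thesis unfolding v01 v2 v3 c e u3 u1 u2 by Groebner_Basis.algebra
  qed
  moreover have "4 dvd v0 + e * (v1 + v2 + v3)" using v by (simp add: lat_def)
  ultimately have "4 dvd (p - r - s) * u0 + e * (q - r + s) * u1"
    by (metis dvd_diff_right_iff)
  hence "4 dvd 2 * (t * u0 + e * t' * u1)" unfolding tt by (simp add: algebra_simps)
  hence "even (t * u0 + e * t' * u1)" by (rule even_if_four_dvd_double)
  hence "even (t + t')" using e oddu by auto
  hence "4 dvd p + q + 2 * r" unfolding tt by presburger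
  thus ?thesis using parity v01 v2 v3 unfolding ord_cond_def by blast
qed

text \<open>Solving for \<open>(2, 0, 2, 0)\<close> and \<open>(2, 0, 0, 2)\<close> shows that half of the determinant \<open>D\<close> divides
  \<open>u2\<close> and \<open>u3\<close>; its square then divides \<open>D\<close>, which leaves only \<open>D = \<plusminus>2\<close>.\<close>

lemma lat_solve_imp:
  assumes e: "e = 1 \<or> e = - 1" and c: "4 dvd c2 - e" "4 dvd c3 - e"
    and u: "lat e u0 u1 u2 u3"
    and ex: "\<And>v0 v1 v2 v3. lat e v0 v1 v2 v3 \<Longrightarrow> \<exists>p q r s. ord_cond p q r s \<and> v0 = p * u0 \<and> v1 = q * u1 \<and>
    v2 = r * u2 - s * c2 * u3 \<and> v3 = r * u3 + s * c3 * u2"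
  shows "\<bar>u0\<bar> = 1" "\<bar>u1\<bar> = 1" "\<bar>c3 * u2\<^sup>2 + c2 * u3\<^sup>2\<bar> = 2"
proof -
  define D where "D = c3 * u2\<^sup>2 + c2 * u3\<^sup>2"
  have odd: "odd c2" "odd c3" using e c(1,2) by presburger+
  have "lat e 2 0 2 0" using e by (auto simp: lat_def)
  from ex[OF this] obtain r' s' where rs: "2 = r' * u2 - s' * c2 * u3" "0 = r' * u3 + s' * c3 * u2" by blast
  have 1: "D * s' = 2 * - u3" "D * r' = 2 * c3 * u2"
    using rs unfolding D_def by Groebner_Basis.algebra+
  have D0: "D \<noteq> 0"
  proof
    assume "D = 0"
    with 1 odd have "u2 = 0" "u3 = 0" by auto
    with rs show False by simp
  qed
  \<comment> \<open>This target has no component in the plane, so r = s = 0, and the order condition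
    then forces p and q to be even. Hence u0 and u1 divide 1.\<close>
  have "lat e 2 2 0 0" using e by (auto simp: lat_def)
  from ex[OF this] obtain p q r s where rs: "ord_cond p q r s" "2 = p * u0" "2 = q * u1"
    "0 = r * u2 - s * c2 * u3" "0 = r * u3 + s * c3 * u2" by blast
  have "D * s = 0" "D * r = 0"
    using rs unfolding D_def by Groebner_Basis.algebra+
  hence "s = 0" "r = 0" using D0 by auto
  hence pq: "even p" "even q" using rs(1) unfolding ord_cond_def by presburger+
  then obtain p' q' where pq: "p = 2 * p'" "q = 2 * q'" by (elim dvdE)
  have "p' * u0 = 1" "q' * u1 = 1" using rs(2,3) unfolding pq by linarith+
  thus u01: "\<bar>u0\<bar> = 1" "\<bar>u1\<bar> = 1" by (auto simp: zmult_eq_1_iff)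
  have oddu: "odd u2" "odd u3" using u u01 unfolding lat_def by presburger+
  hence "even D" using odd by (simp add: D_def)
  then obtain D' where D': "D = 2 * D'" by blast
  have "lat e 2 0 0 2" using e by (auto simp: lat_def)
  from ex[OF this] obtain r s where rs: "0 = r * u2 - s * c2 * u3" "2 = r * u3 + s * c3 * u2" by blast
  have "D * s = 2 * u2" using rs unfolding D_def by Groebner_Basis.algebra
  hence "u2 = D' * s" using D' by simp
  moreover have "- u3 = D' * s'" using 1(1) D' by simp
  ultimately have dv: "D' dvd u2" "D' dvd u3" by (metis dvd_triv_left dvd_minus_iff)+
  have "D' * D' dvd u2\<^sup>2" "D' * D' dvd u3\<^sup>2"
    unfolding power2_eq_square by (rule mult_dvd_mono[OF dv(1) dv(1)], rule mult_dvd_mono[OF dv(2) dv(2)])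
  hence "D' * D' dvd D" unfolding D_def by (rule dvd_add[OF dvd_mult dvd_mult])
  hence "D' dvd 2" using D' D0 by (simp add: mult.commute)
  hence "\<bar>D'\<bar> \<le> 2" using dvd_imp_le_int[of 2 D'] by simp
  moreover have "odd D'" using dv oddu by (meson dvd_trans)
  ultimately have "\<bar>D'\<bar> = 1" by presburger
  thus "\<bar>c3 * u2\<^sup>2 + c2 * u3\<^sup>2\<bar> = 2" using D' unfolding D_def by simp
qed

text \<open>The two summands have the parity of x and of y, and their sum is even; if x and y were
  both even, 4 would divide the form.\<close>

lemma odd_if_abs_form_eq_2:
  fixes a b :: int
  assumes "odd a" "odd b" "\<bar>a * x\<^sup>2 + b * y\<^sup>2\<bar> = 2"
  shows "odd x \<and> odd y"
proof (rule ccontr)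
  assume *: "\<not> (odd x \<and> odd y)"
  have "a * x\<^sup>2 + b * y\<^sup>2 = 2 \<or> a * x\<^sup>2 + b * y\<^sup>2 = - 2" using assms(3) by linarith
  moreover have "even t \<and> \<not> 4 dvd t" if "t = 2 \<or> t = - 2" for t :: int using that by presburger
  ultimately have D: "even (a * x\<^sup>2 + b * y\<^sup>2) \<and> \<not> 4 dvd a * x\<^sup>2 + b * y\<^sup>2" by blast
  hence "even x" "even y" using assms(1,2) * by simp_all
  hence "4 dvd a * x\<^sup>2 + b * y\<^sup>2" by (auto elim!: dvdE simp: power_mult_distrib)
  thus False using D by blast
qed

subsection \<open>Biquadratic fields in symmetric coordinates\<close>

lemma mem_Gal_iff:
  "\<phi> \<in> carrier (Gal L K) \<longleftrightarrow> \<phi> \<in> extensional L \<and> bij_betw \<phi> L L \<and>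
     (\<forall>x\<in>L. \<forall>y\<in>L. \<phi> (x + y) = \<phi> x + \<phi> y) \<and> (\<forall>x\<in>L. \<forall>y\<in>L. \<phi> (x * y) = \<phi> x * \<phi> y) \<and>
     \<phi> 1 = 1 \<and> (\<forall>x\<in>K. \<phi> x = x)"
  by (auto simp: Gal_def Bij_def Ring.ring_hom_def ring_of_type_algebra_def bij_betw_apply)

lemma one_Gal: "\<one>\<^bsub>Gal L K\<^esub> = (\<lambda>x\<in>L. x)"
  by (simp add: Gal_def BijGroup_def)

lemma mult_Gal:
  "\<lbrakk>\<phi> \<in> carrier (Gal L K); \<psi> \<in> carrier (Gal L K)\<rbrakk> \<Longrightarrow> \<phi> \<otimes>\<^bsub>Gal L K\<^esub> \<psi> = compose L \<phi> \<psi>"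
  by (auto simp: Gal_def BijGroup_def)

text \<open>The roots are arguments, so that a rotation of the indices or an automorphism applied to
  the roots yields \<open>elt\<close> again, with other arguments.\<close>

definition elt :: "complex \<Rightarrow> complex \<Rightarrow> complex \<Rightarrow> rat \<Rightarrow> rat \<Rightarrow> rat \<Rightarrow> rat \<Rightarrow> complex" where
  "elt r1 r2 r3 a0 a1 a2 a3 = of_rat a0 + of_rat a1 * r1 + of_rat a2 * r2 + of_rat a3 * r3"

lemma elt_rotate: "elt r1 r2 r3 a0 a1 a2 a3 = elt r2 r3 r1 a0 a2 a3 a1"
  by (simp add: elt_def)

text \<open>In lowest terms the square of the denominator of q divides c.\<close>

lemma int_if_squarefree_mult_square_int:
  fixes c N :: int and q :: rat
  assumes "squarefree c" "of_int c * q\<^sup>2 = of_int N"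
  shows "\<exists>u :: int. q = of_int u"
proof -
  obtain a b where ab: "quotient_of q = (a, b)" by fastforce
  have b: "b > 0" "coprime a b" "q = of_int a / of_int b"
    using quotient_of_denom_pos[OF ab] quotient_of_coprime[OF ab] quotient_of_div[OF ab] by auto
  have "of_int (c * a\<^sup>2) = (of_int (N * b\<^sup>2) :: rat)"
    using assms(2) b(1,3) by (simp add: field_simps)
  hence "c * a\<^sup>2 = N * b\<^sup>2" by (simp only: of_int_eq_iff)
  hence "b\<^sup>2 dvd c * a\<^sup>2" by simp
  hence "b\<^sup>2 dvd c"
    using b(2) by (simp add: coprime_dvd_mult_left_iff coprime_commute)
  hence "is_unit b" using assms(1) by (auto simp: squarefree_def)
  hence "b = 1" using b(1) by simp
  thus ?thesis using b(3) by auto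
qed

text \<open>With \<open>r1 = \<surd>m\<close>, \<open>r2 = \<surd>n\<close>, \<open>r3 = \<surd>k\<close> the constants are \<open>c1 = n / d\<close>, \<open>c2 = m / d\<close>, \<open>c3 = d\<close>.
  All assumptions are invariant under cyclic rotation of the indices.\<close>

locale klein =
  fixes c1 c2 c3 e :: int and r1 r2 r3 :: complex and L :: "complex set"
  assumes e: "e = 1 \<or> e = - 1"
    and c_cong: "4 dvd c1 - e" "4 dvd c2 - e" "4 dvd c3 - e"
    and sqf: "squarefree (c1 * c2 * c3)"
    and r_mult: "r1 * r2 = of_int c3 * r3" "r2 * r3 = of_int c1 * r1" "r3 * r1 = of_int c2 * r2"
    and r_sq: "r1\<^sup>2 = of_int (c2 * c3)" "r2\<^sup>2 = of_int (c3 * c1)" "r3\<^sup>2 = of_int (c1 * c2)"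
    and mem_L: "\<And>x. x \<in> L \<longleftrightarrow> (\<exists>a0 a1 a2 a3. x = elt r1 r2 r3 a0 a1 a2 a3)"
    and indep: "\<And>a0 a1 a2 a3. elt r1 r2 r3 a0 a1 a2 a3 = 0 \<Longrightarrow> a0 = 0 \<and> a1 = 0 \<and> a2 = 0 \<and> a3 = 0"
    and aut: "\<And>i j. i\<^sup>2 = 1 \<Longrightarrow> j\<^sup>2 = 1 \<Longrightarrow>
      \<exists>\<phi>\<in>carrier (Gal L \<rat>). \<phi> r1 = i * r1 \<and> \<phi> r2 = j * r2"
begin

abbreviation E where "E \<equiv> elt r1 r2 r3"

lemma E_mem [simp]: "E a0 a1 a2 a3 \<in> L"
  by (auto simp: mem_L)

lemma odd_c: "odd c1" "odd c2" "odd c3"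
  using c_cong e by presburger+

lemma of_rat_mem [simp]: "of_rat a \<in> L"
  using E_mem[of a 0 0 0] by (simp add: elt_def)

lemma r_mem [simp]: "of_rat a * r1 \<in> L" "of_rat a * r2 \<in> L" "of_rat a * r3 \<in> L" "r1 \<in> L" "r2 \<in> L" "r3 \<in> L"
  using E_mem[of 0 a 0 0] E_mem[of 0 0 a 0] E_mem[of 0 0 0 a]
    E_mem[of 0 1 0 0] E_mem[of 0 0 1 0] E_mem[of 0 0 0 1] by (simp_all add: elt_def)

lemma E_add: "E a0 a1 a2 a3 + E b0 b1 b2 b3 = E (a0 + b0) (a1 + b1) (a2 + b2) (a3 + b3)"
  by (simp add: elt_def of_rat_add algebra_simps)

lemma E_scale: "of_rat t * E a0 a1 a2 a3 = E (t * a0) (t * a1) (t * a2) (t * a3)"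
  by (simp add: elt_def of_rat_mult algebra_simps)

lemma E_diff: "E a0 a1 a2 a3 - E b0 b1 b2 b3 = E (a0 - b0) (a1 - b1) (a2 - b2) (a3 - b3)"
  by (simp add: elt_def of_rat_diff algebra_simps)

lemma E_inject: "E a0 a1 a2 a3 = E b0 b1 b2 b3 \<longleftrightarrow> a0 = b0 \<and> a1 = b1 \<and> a2 = b2 \<and> a3 = b3"
  using indep[of "a0 - b0" "a1 - b1" "a2 - b2" "a3 - b3"] by (auto simp flip: E_diff)

lemma r_nonzero: "r1 \<noteq> 0" "r2 \<noteq> 0" "r3 \<noteq> 0"
  using indep[of 0 1 0 0] indep[of 0 0 1 0] indep[of 0 0 0 1] by (auto simp: elt_def)

lemma E_mult_r1: "r1 * E a0 a1 a2 a3 = E (of_int (c2 * c3) * a1) a0 (of_int c2 * a3) (of_int c3 * a2)"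
proof -
  have "r1 * E a0 a1 a2 a3 = of_rat a0 * r1 + of_rat a1 * r1\<^sup>2 + of_rat a2 * (r1 * r2) + of_rat a3 * (r3 * r1)"
    by (simp add: elt_def algebra_simps power2_eq_square)
  thus ?thesis unfolding r_mult r_sq by (simp add: elt_def of_rat_mult algebra_simps)
qed

lemma L_closed: "x \<in> L \<Longrightarrow> y \<in> L \<Longrightarrow> x + y \<in> L" "x \<in> L \<Longrightarrow> of_rat t * x \<in> L" "x \<in> L \<Longrightarrow> r1 * x \<in> L"
  unfolding mem_L using E_add E_scale E_mult_r1 by metis+

section \<open>Galois action on coordinates\<close>

lemma Gal_of_rat: "\<phi> \<in> carrier (Gal L \<rat>) \<Longrightarrow> \<phi> (of_rat a) = of_rat a"
  by (simp add: mem_Gal_iff)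

lemma Gal_E:
  assumes "\<phi> \<in> carrier (Gal L \<rat>)"
  shows "\<phi> (E a0 a1 a2 a3) = elt (\<phi> r1) (\<phi> r2) (\<phi> r3) a0 a1 a2 a3"
proof -
  have add: "\<phi> (x + y) = \<phi> x + \<phi> y" and mult: "\<phi> (x * y) = \<phi> x * \<phi> y" if "x \<in> L" "y \<in> L" for x y
    using assms that by (auto simp: mem_Gal_iff)
  show ?thesis
    by (simp add: elt_def add mult L_closed Gal_of_rat[OF assms])
qed

lemma Gal_r:
  assumes "\<phi> \<in> carrier (Gal L \<rat>)"
  shows "\<phi> r1 = r1 \<or> \<phi> r1 = - r1" "\<phi> r2 = r2 \<or> \<phi> r2 = - r2" "of_int c3 * \<phi> r3 = \<phi> r1 * \<phi> r2"
proof -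
  have mult: "\<phi> (x * y) = \<phi> x * \<phi> y" if "x \<in> L" "y \<in> L" for x y
    using assms that by (auto simp: mem_Gal_iff)
  have i: "\<phi> (of_int a) = of_int a" for a using Gal_of_rat[OF assms, of "of_int a"] by simp
  have im: "(of_int a :: complex) \<in> L" for a using of_rat_mem[of "of_int a"] by simp
  have "(\<phi> r1)\<^sup>2 = r1\<^sup>2" "(\<phi> r2)\<^sup>2 = r2\<^sup>2"
    by (simp_all add: power2_eq_square flip: mult) (simp_all add: r_sq[unfolded power2_eq_square] i del: of_int_mult)
  thus "\<phi> r1 = r1 \<or> \<phi> r1 = - r1" "\<phi> r2 = r2 \<or> \<phi> r2 = - r2" by (simp_all add: power2_eq_iff)
  show "of_int c3 * \<phi> r3 = \<phi> r1 * \<phi> r2"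
    by (simp add: i im r_mult flip: mult) (simp add: i im mult)
qed

lemma Gal_r3:
  assumes "\<phi> \<in> carrier (Gal L \<rat>)" "\<phi> r1 = i * r1" "\<phi> r2 = j * r2"
  shows "\<phi> r3 = i * j * r3"
proof -
  have "of_int c3 * \<phi> r3 = of_int c3 * (i * j * r3)"
    using Gal_r(3)[OF assms(1)] r_mult(1) unfolding assms(2,3) by (simp add: ac_simps flip: r_mult(1))
  thus ?thesis using odd_c by auto
qed

text \<open>The automorphism fixes integer coefficients, so the image is a root of the same monic
  polynomial. Closure of L under multiplication by x is a hypothesis because only multiplication by
  r1 has been treated so far; \<open>algebraic_int_Gal_E\<close> supplies it through the rotated
  locales.\<close>

lemma Gal_algebraic_int:
  assumes "\<phi> \<in> carrier (Gal L \<rat>)" "x \<in> L" "algebraic_int x" and mult: "\<And>y. y \<in> L \<Longrightarrow> x * y \<in> L"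
  shows "algebraic_int (\<phi> x)"
proof -
  have *: "poly (of_int_poly p) x \<in> L \<and> \<phi> (poly (of_int_poly p) x) = poly (of_int_poly p) (\<phi> x)" for p
  proof (induction p)
    case 0
    show ?case using of_rat_mem[of 0] Gal_of_rat[OF assms(1), of 0] by simp
  next
    case (pCons a p)
    have "(of_int a :: complex) \<in> L" "\<phi> (of_int a) = of_int a"
      using of_rat_mem[of "of_int a"] Gal_of_rat[OF assms(1), of "of_int a"] by simp_all
    with pCons.hyps pCons.IH mult assms(1,2) show ?case
      by (auto simp: mem_Gal_iff L_closed map_poly_pCons)
  qed
  obtain p where p: "poly (of_int_poly p) x = 0" "lead_coeff p = 1"
    using assms(3) by (auto simp: algebraic_int_altdef_ipoly)
  have "poly (of_int_poly p) (\<phi> x) = 0"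
    using *[of p] p(1) Gal_of_rat[OF assms(1), of 0] by simp
  thus ?thesis using p(2) unfolding algebraic_int_altdef_ipoly by blast
qed

text \<open>Only \<open>aut\<close> is not a mere permutation of an assumption. As r3 is r1 r2 up to
  a rational factor, the signs i on r2 and j on r3 amount to the signs i j on r1 and i on
  r2.\<close>

lemma klein_rotate: "klein c2 c3 c1 e r2 r3 r1 L"
proof
  show "x \<in> L \<longleftrightarrow> (\<exists>a0 a1 a2 a3. x = elt r2 r3 r1 a0 a1 a2 a3)" for x
    unfolding mem_L elt_rotate[of r1] by blast
  show "\<exists>\<phi>\<in>carrier (Gal L \<rat>). \<phi> r2 = i * r2 \<and> \<phi> r3 = j * r3" if "i\<^sup>2 = 1" "j\<^sup>2 = 1" for i j
  proof -
    obtain \<phi> where \<phi>: "\<phi> \<in> carrier (Gal L \<rat>)" "\<phi> r1 = i * j * r1" "\<phi> r2 = i * r2"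
      using aut[of "i * j" i] \<open>i\<^sup>2 = 1\<close> \<open>j\<^sup>2 = 1\<close> by (auto simp: power_mult_distrib)
    moreover have "\<phi> r3 = j * r3"
      using Gal_r3[OF \<phi>] \<open>i\<^sup>2 = 1\<close> by (simp add: power2_eq_square ac_simps)
    ultimately show ?thesis by blast
  qed
  show "squarefree (c2 * c3 * c1)" using sqf by (simp add: ac_simps)
  show "elt r2 r3 r1 a0 a1 a2 a3 = 0 \<Longrightarrow> a0 = 0 \<and> a1 = 0 \<and> a2 = 0 \<and> a3 = 0" for a0 a1 a2 a3
    using indep[of a0 a3 a1 a2] by (simp add: elt_rotate[of r1])
qed (use e c_cong r_mult r_sq in auto)

lemma algebraic_int_Gal_E:
  assumes "\<phi> \<in> carrier (Gal L \<rat>)" "algebraic_int (E a0 a1 a2 a3)"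
  shows "algebraic_int (\<phi> (E a0 a1 a2 a3))"
proof (rule Gal_algebraic_int[OF assms(1) _ assms(2)])
  interpret rot: klein c2 c3 c1 e r2 r3 r1 L by (rule klein_rotate)
  interpret rot': klein c3 c1 c2 e r3 r1 r2 L by (rule rot.klein_rotate)
  fix y assume "y \<in> L"
  have "E a0 a1 a2 a3 * y = of_rat a0 * y + of_rat a1 * (r1 * y) + of_rat a2 * (r2 * y) + of_rat a3 * (r3 * y)"
    by (simp add: elt_def algebra_simps)
  also have "\<dots> \<in> L" using \<open>y \<in> L\<close> by (intro L_closed rot.L_closed(3) rot'.L_closed(3))
  finally show "E a0 a1 a2 a3 * y \<in> L" .
qed simp

section \<open>The ring of integers in coordinates\<close>

text \<open>The trace to Q(r1) is 2 a0 + 2 a1 r1. Its own trace 4 a0 and norm N = 4 a0^2 - 4 a1^2 c2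
  c3 over Q are rational algebraic integers, hence integers. So c2 c3 (4 a1)^2 = (4 a0)^2 - 4 N is
  an integer, which makes 4 a1 an integer since c2 c3 is squarefree, and comparing parities
  finishes. Rotation gives the remaining coordinates.\<close>

lemma algebraic_int_coeffs:
  assumes "algebraic_int (E a0 a1 a2 a3)"
  shows "\<exists>u0 u1. a0 = of_int u0 / 4 \<and> a1 = of_int u1 / 4 \<and> even (u1 - u0)"
proof -
  obtain \<phi> where \<phi>: "\<phi> \<in> carrier (Gal L \<rat>)" "\<phi> r1 = 1 * r1" "\<phi> r2 = - 1 * r2"
    using aut[of 1 "- 1"] by auto
  obtain \<psi> where \<psi>: "\<psi> \<in> carrier (Gal L \<rat>)" "\<psi> r1 = - 1 * r1" "\<psi> r2 = 1 * r2"
    using aut[of "- 1" 1] by auto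
  have "algebraic_int (E a0 a1 a2 a3 + \<phi> (E a0 a1 a2 a3))"
    by (rule algebraic_int_plus_times(1)[OF assms algebraic_int_Gal_E[OF \<phi>(1) assms]])
  also have "E a0 a1 a2 a3 + \<phi> (E a0 a1 a2 a3) = E (2 * a0) (2 * a1) 0 0"
    using Gal_r3[OF \<phi>] by (simp add: Gal_E[OF \<phi>(1)] \<phi>(2,3)) (simp add: elt_def of_rat_mult)
  finally have y: "algebraic_int (E (2 * a0) (2 * a1) 0 0)" .
  have y': "\<psi> (E (2 * a0) (2 * a1) 0 0) = E (2 * a0) (- (2 * a1)) 0 0"
    by (simp add: Gal_E[OF \<psi>(1)] \<psi>(2,3)) (simp add: elt_def of_rat_minus)
  note * = algebraic_int_plus_times[OF y algebraic_int_Gal_E[OF \<psi>(1) y], unfolded y']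
  have "E (2 * a0) (2 * a1) 0 0 + E (2 * a0) (- (2 * a1)) 0 0 = of_rat (4 * a0)"
    by (simp add: elt_def of_rat_mult of_rat_minus)
  then obtain u0 where u0: "4 * a0 = of_int u0" using *(1) algebraic_int_of_rat by metis
  have "E (2 * a0) (2 * a1) 0 0 * E (2 * a0) (- (2 * a1)) 0 0 = of_rat (4 * a0\<^sup>2) - of_rat (4 * a1\<^sup>2) * r1\<^sup>2"
    by (simp add: elt_def of_rat_mult of_rat_minus power2_eq_square algebra_simps)
  also have "\<dots> = of_rat (4 * a0\<^sup>2 - 4 * a1\<^sup>2 * of_int (c2 * c3))"
    unfolding r_sq of_rat_diff of_rat_mult of_rat_of_int_eq ..
  finally obtain N where N: "4 * a0\<^sup>2 - 4 * a1\<^sup>2 * of_int (c2 * c3) = of_int N"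
    using *(2) algebraic_int_of_rat by metis
  have "of_int (c2 * c3) * (4 * a1)\<^sup>2 = (4 * a0)\<^sup>2 - 4 * (4 * a0\<^sup>2 - 4 * a1\<^sup>2 * of_int (c2 * c3))"
    by (simp add: power2_eq_square algebra_simps)
  also have "\<dots> = of_int (u0\<^sup>2 - 4 * N)" unfolding N u0 by simp
  finally have 1: "of_int (c2 * c3) * (4 * a1)\<^sup>2 = of_int (u0\<^sup>2 - 4 * N)" .
  have "squarefree (c2 * c3)" using sqf by (rule squarefree_mono[rotated]) simp
  from int_if_squarefree_mult_square_int[OF this 1] obtain u1 where u1: "4 * a1 = of_int u1" by blast
  have "of_int (c2 * c3 * u1\<^sup>2) = (of_int (u0\<^sup>2 - 4 * N) :: rat)" using 1 by (simp add: u1)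
  hence "c2 * c3 * u1\<^sup>2 = u0\<^sup>2 - 4 * N" by (simp only: of_int_eq_iff)
  hence "even (c2 * c3 * u1\<^sup>2) = even (u0\<^sup>2)" by simp
  hence "even (u1 - u0)" using odd_c by simp
  with u0 u1 show ?thesis by (intro exI[of _ u0] exI[of _ u1]) (auto simp: field_simps)
qed

definition Q :: "int \<Rightarrow> int \<Rightarrow> int \<Rightarrow> int \<Rightarrow> complex" where
  "Q u0 u1 u2 u3 = E (of_int u0 / 4) (of_int u1 / 4) (of_int u2 / 4) (of_int u3 / 4)"

lemma Q_altdef: "Q u0 u1 u2 u3 = (of_int u0 + of_int u1 * r1 + of_int u2 * r2 + of_int u3 * r3) / 4"
  by (simp add: Q_def elt_def of_rat_divide add_divide_distrib)

lemma Q_diff: "Q u0 u1 u2 u3 - Q v0 v1 v2 v3 = Q (u0 - v0) (u1 - v1) (u2 - v2) (u3 - v3)"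
  by (simp add: Q_altdef algebra_simps diff_divide_distrib add_divide_distrib)

lemma Q_inject: "Q u0 u1 u2 u3 = Q v0 v1 v2 v3 \<longleftrightarrow> u0 = v0 \<and> u1 = v1 \<and> u2 = v2 \<and> u3 = v3"
  by (simp add: Q_def E_inject)

text \<open>It is a root of X^2 - X + (1 - c2 c3) / 4, and c2 c3 is congruent to e^2 = 1 modulo
  4.\<close>

lemma algebraic_int_half: "algebraic_int ((1 + r1) / 2)"
proof -
  have "4 dvd 1 - c2 * c3"
  proof -
    obtain x y where c: "c2 = e + 4 * x" "c3 = e + 4 * y"
      using c_cong by (metis dvdE add.commute diff_eq_eq)
    show ?thesis using e
    proof
      assume e: "e = 1"
      show ?thesis unfolding c e by (intro dvdI[where k = "- (x + y + 4 * x * y)"]) (simp add: algebra_simps)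
    next
      assume e: "e = - 1"
      show ?thesis unfolding c e by (intro dvdI[where k = "x + y - 4 * x * y"]) (simp add: algebra_simps)
    qed
  qed
  then obtain t where t: "1 - c2 * c3 = 4 * t" by blast
  have "poly (of_int_poly [:t, - 1, 1:]) ((1 + r1) / 2) = of_int t + (r1\<^sup>2 - 1) / 4"
    by (simp add: field_simps power2_eq_square)
  also have "\<dots> = of_int t - of_int (1 - c2 * c3) / 4" unfolding r_sq by (simp add: diff_divide_distrib)
  also have "\<dots> = 0" unfolding t by simp
  finally show ?thesis
    unfolding algebraic_int_altdef_ipoly by (intro exI[of _ "[:t, - 1, 1:]"]) auto
qed

text \<open>Reduction by known integers. Subtracting u3 times \<open>Q 1 1 c2 1\<close>, the product
  of (1 + r1) / 2 and (1 + r3) / 2, removes the last coordinate. If the parities agree, the other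
  coordinates are now even, and multiples of (1 + r1) / 2 and (1 + r2) / 2 reduce the element to a
  rational number, where integrality is plain. If they disagree, \<open>algebraic_int_coeffs\<close>
  excludes integrality.\<close>

lemma algebraic_int_Q_iff: "algebraic_int (Q u0 u1 u2 u3) \<longleftrightarrow> lat e u0 u1 u2 u3"
proof -
  interpret rot: klein c2 c3 c1 e r2 r3 r1 L by (rule klein_rotate)
  interpret rot': klein c3 c1 c2 e r3 r1 r2 L by (rule rot.klein_rotate)
  have half: "algebraic_int (Q 2 2 0 0)" "algebraic_int (Q 2 0 2 0)" "algebraic_int (Q 2 0 0 2)"
  proof -
    have halves: "Q 2 2 0 0 = (1 + r1) / 2" "Q 2 0 2 0 = (1 + r2) / 2" "Q 2 0 0 2 = (1 + r3) / 2"
      by (simp_all add: Q_altdef field_simps)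
    show "algebraic_int (Q 2 2 0 0)" "algebraic_int (Q 2 0 2 0)" "algebraic_int (Q 2 0 0 2)"
      unfolding halves by (rule algebraic_int_half rot.algebraic_int_half rot'.algebraic_int_half)+
  qed
  have "Q 1 1 c2 1 = Q 2 2 0 0 * Q 2 0 0 2"
    using r_mult(3) by (simp add: Q_altdef field_simps)
  hence g: "algebraic_int (Q 1 1 c2 1)" using half algebraic_int_plus_times(2) by simp
  have int: "algebraic_int (of_int n :: complex)" for n by (rule int_imp_algebraic_int) auto
  have red: "algebraic_int (Q (u0 - u3) (u1 - u3) (u2 - c2 * u3) 0) \<longleftrightarrow> algebraic_int (Q u0 u1 u2 u3)"
  proof -
    have "of_int u3 * Q 1 1 c2 1 = Q u3 u3 (c2 * u3) u3" by (simp add: Q_altdef algebra_simps)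
    hence "algebraic_int (Q u3 u3 (c2 * u3) u3)" using algebraic_int_plus_times(2)[OF int g] by metis
    moreover have "Q u0 u1 u2 u3 - Q u3 u3 (c2 * u3) u3 = Q (u0 - u3) (u1 - u3) (u2 - c2 * u3) 0"
      by (simp add: Q_diff)
    ultimately show ?thesis
      using algebraic_int_diff algebraic_int_plus_times(1) by (metis diff_add_cancel)
  qed
  have even: "algebraic_int (Q (2 * w0) (2 * w1) (2 * w2) 0) \<longleftrightarrow> even (w0 - w1 - w2)" for w0 w1 w2
  proof -
    let ?s = "of_int w1 * Q 2 2 0 0 + of_int w2 * Q 2 0 2 0"
    have s: "algebraic_int ?s" by (intro algebraic_int_plus_times int half)
    have eq: "Q (2 * w0) (2 * w1) (2 * w2) 0 - ?s = of_rat (of_int (w0 - w1 - w2) / 2)"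
      by (simp add: Q_altdef of_rat_divide of_rat_diff of_rat_add field_simps)
    have "algebraic_int (Q (2 * w0) (2 * w1) (2 * w2) 0) \<longleftrightarrow> algebraic_int (of_rat (of_int (w0 - w1 - w2) / 2) :: complex)"
      unfolding eq[symmetric] using s algebraic_int_diff algebraic_int_plus_times(1) by (metis diff_add_cancel)
    also have "\<dots> \<longleftrightarrow> even (w0 - w1 - w2)"
    proof
      assume "algebraic_int (of_rat (of_int (w0 - w1 - w2) / 2) :: complex)"
      then obtain v where "of_int (w0 - w1 - w2) / 2 = (of_int v :: rat)"
        using algebraic_int_of_rat by blast
      hence "of_int (w0 - w1 - w2) = (of_int (2 * v) :: rat)" by simp
      hence "w0 - w1 - w2 = 2 * v" by (simp only: of_int_eq_iff)
      thus "even (w0 - w1 - w2)" by simp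
    next
      assume "even (w0 - w1 - w2)"
      then obtain v where v: "w0 - w1 - w2 = 2 * v" by blast
      show "algebraic_int (of_rat (of_int (w0 - w1 - w2) / 2) :: complex)"
        unfolding v using int[of v] by simp
    qed
    finally show ?thesis .
  qed
  show ?thesis
  proof (cases "even (u1 - u0) \<and> even (u2 - u0) \<and> even (u3 - u0)")
    case True
    have "even (u0 - u3)" "even (u1 - u3)" "even (u2 - c2 * u3)" using True odd_c by auto
    then obtain w0 w1 w2 where w: "u0 - u3 = 2 * w0" "u1 - u3 = 2 * w1" "u2 - c2 * u3 = 2 * w2"
      by (elim dvdE)
    have "algebraic_int (Q u0 u1 u2 u3) \<longleftrightarrow> even (w0 - w1 - w2)" unfolding even[symmetric] w[symmetric] red ..
    also have "\<dots> \<longleftrightarrow> 4 dvd 2 * (w0 - w1 - w2)" by presburger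
    also have "2 * (w0 - w1 - w2) = u0 - u1 - u2 + c2 * u3" using w by (simp add: algebra_simps)
    finally show ?thesis unfolding lat_alt[OF e c_cong(2)] using True by simp
  next
    case False
    have "even (u1 - u0) \<and> even (u2 - u0) \<and> even (u3 - u0)" if "algebraic_int (Q u0 u1 u2 u3)"
    proof -
      note q = that[unfolded Q_def]
      note q' = q[unfolded elt_rotate[of r1]]
      note q'' = q'[unfolded elt_rotate[of r2]]
      show ?thesis
        using algebraic_int_coeffs[OF q] rot.algebraic_int_coeffs[OF q'] rot'.algebraic_int_coeffs[OF q'']
        by auto
    qed
    thus ?thesis using False by (auto simp: lat_def)
  qed
qed

lemma ring_of_integers_iff:
  "x \<in> ring_of_integers L \<longleftrightarrow> (\<exists>u0 u1 u2 u3. x = Q u0 u1 u2 u3 \<and> lat e u0 u1 u2 u3)"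
proof
  interpret rot: klein c2 c3 c1 e r2 r3 r1 L by (rule klein_rotate)
  interpret rot': klein c3 c1 c2 e r3 r1 r2 L by (rule rot.klein_rotate)
  assume "x \<in> ring_of_integers L"
  then obtain a0 a1 a2 a3 where x: "x = E a0 a1 a2 a3" and q: "algebraic_int (E a0 a1 a2 a3)"
    by (auto simp: ring_of_integers_def mem_L)
  note q' = q[unfolded elt_rotate[of r1]]
  note q'' = q'[unfolded elt_rotate[of r2]]
  obtain u0 u1 u2 u3 where "a0 = of_int u0 / 4" "a1 = of_int u1 / 4" "a2 = of_int u2 / 4" "a3 = of_int u3 / 4"
    using algebraic_int_coeffs[OF q] rot.algebraic_int_coeffs[OF q'] rot'.algebraic_int_coeffs[OF q'']
    by blast
  hence "x = Q u0 u1 u2 u3" by (simp only: x Q_def)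
  with q x algebraic_int_Q_iff show "\<exists>u0 u1 u2 u3. x = Q u0 u1 u2 u3 \<and> lat e u0 u1 u2 u3" by metis
qed (auto simp: ring_of_integers_def algebraic_int_Q_iff, auto simp: Q_def)

end

subsection \<open>Associated orders and generators\<close>

lemma complex_ring_simps:
  "\<zero>\<^bsub>complex_ring\<^esub> = 0" "\<one>\<^bsub>complex_ring\<^esub> = 1" "x \<oplus>\<^bsub>complex_ring\<^esub> y = x + y"
  "x \<otimes>\<^bsub>complex_ring\<^esub> y = x * y" "carrier complex_ring = UNIV"
  by (simp_all add: ring_of_type_algebra_def)

lemma complex_ring_minus: "\<ominus>\<^bsub>complex_ring\<^esub> x = - x"
proof -
  interpret field complex_ring by (rule field_from_type_algebra)
  show ?thesis by (rule minus_equality) (simp_all add: complex_ring_simps)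
qed

lemma complex_ring_inverse: "x \<noteq> 0 \<Longrightarrow> inv\<^bsub>complex_ring\<^esub> x = inverse x"
proof -
  interpret field complex_ring by (rule field_from_type_algebra)
  show "x \<noteq> 0 \<Longrightarrow> ?thesis" by (rule comm_inv_char) (simp_all add: complex_ring_simps)
qed

lemma rat_adjoin_induct [consumes 1, case_names rat gen minus inverse add mult]:
  assumes "x \<in> rat_adjoin S"
    and "\<And>a. P (of_rat a)" and "\<And>s. s \<in> S \<Longrightarrow> P s" and "\<And>x. P x \<Longrightarrow> P (- x)"
    and "\<And>x. P x \<Longrightarrow> x \<noteq> 0 \<Longrightarrow> P (inverse x)"
    and "\<And>x y. P x \<Longrightarrow> P y \<Longrightarrow> P (x + y)" and "\<And>x y. P x \<Longrightarrow> P y \<Longrightarrow> P (x * y)"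
  shows "P x"
  using assms(1) unfolding rat_adjoin_def
proof (induction rule: generate_field.induct)
  case one
  show ?case using assms(2)[of 1] by (simp add: complex_ring_simps)
next
  case (incl h)
  thus ?case using assms(2,3) by (auto elim!: Rats_cases)
next
  case (m_inv h)
  thus ?case using assms(5) by (simp add: complex_ring_inverse complex_ring_simps)
qed (use assms in \<open>simp_all add: complex_ring_minus complex_ring_simps\<close>)

lemma rat_adjoin_mem: "of_rat a \<in> rat_adjoin S" "s \<in> S \<Longrightarrow> s \<in> rat_adjoin S"
  unfolding rat_adjoin_def by (auto intro: generate_field.incl)

context klein
begin

text \<open>Lets an automorphism that fixes r1 be recognised as fixing all of Q(r1).\<close>

lemma rat_adjoin_r1: "x \<in> rat_adjoin {r1} \<Longrightarrow> \<exists>a b. x = E a b 0 0"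
proof (induction rule: rat_adjoin_induct)
  case (rat a)
  show ?case by (rule exI[of _ a], rule exI[of _ 0]) (simp add: elt_def)
next
  case (gen s)
  thus ?case by (intro exI[of _ 0] exI[of _ 1]) (simp add: elt_def)
next
  case (minus x)
  then obtain a b where "x = E a b 0 0" by blast
  thus ?case by (intro exI[of _ "- a"] exI[of _ "- b"]) (simp add: elt_def of_rat_minus)
next
  case (inverse x)
  then obtain a b where x: "x = E a b 0 0" by blast
  \<comment> \<open>N is the norm of a + b r1; the inverse is the conjugate divided by it.\<close>
  define N where "N = a\<^sup>2 - b\<^sup>2 * of_int (c2 * c3)"
  have "x * E a (- b) 0 0 = of_rat (a\<^sup>2) - of_rat (b\<^sup>2) * r1\<^sup>2"
    by (simp add: x elt_def of_rat_minus of_rat_mult power2_eq_square algebra_simps)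
  also have "\<dots> = of_rat N"
    unfolding r_sq N_def of_rat_diff of_rat_mult of_rat_of_int_eq ..
  finally have N: "x * E a (- b) 0 0 = of_rat N" .
  have "E a (- b) 0 0 \<noteq> 0" using indep[of a "- b" 0 0] inverse x by (auto simp: elt_def)
  hence "of_rat N \<noteq> (0 :: complex)" using N inverse by (metis mult_eq_0_iff)
  hence "inverse x = of_rat (1 / N) * E a (- b) 0 0"
    using N inverse(2) by (simp add: of_rat_divide field_simps)
  thus ?case unfolding E_scale by auto
next
  case (add x y)
  then obtain a b a' b' where "x = E a b 0 0" "y = E a' b' 0 0" by blast
  hence "x + y = E (a + a') (b + b') 0 0" by (simp add: E_add)
  thus ?case by blast
next
  case (mult x y)
  then obtain a b a' b' where xy: "x = E a b 0 0" "y = E a' b' 0 0" by blast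
  hence "x * y = of_rat a * y + of_rat b * (r1 * y)" by (simp add: elt_def algebra_simps)
  thus ?case unfolding xy E_mult_r1 E_scale E_add by (metis add_0 mult_zero_right)
qed

lemma mem_Gal_r1_iff: "\<phi> \<in> carrier (Gal L (rat_adjoin {r1})) \<longleftrightarrow> \<phi> \<in> carrier (Gal L \<rat>) \<and> \<phi> r1 = r1"
proof
  assume \<phi>: "\<phi> \<in> carrier (Gal L \<rat>) \<and> \<phi> r1 = r1"
  have "\<phi> (E a b 0 0) = E a b 0 0" for a b
    using \<phi> Gal_E[of \<phi> a b 0 0] by (simp add: elt_def)
  hence "\<forall>x\<in>rat_adjoin {r1}. \<phi> x = x" using rat_adjoin_r1 by metis
  with \<phi> show "\<phi> \<in> carrier (Gal L (rat_adjoin {r1}))" by (simp add: mem_Gal_iff)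
qed (auto simp: mem_Gal_iff rat_adjoin_mem elim!: Rats_cases)

lemma Gal_eq_id:
  assumes "\<phi> \<in> carrier (Gal L \<rat>)" "\<phi> r1 = r1" "\<phi> r2 = r2"
  shows "\<phi> = (\<lambda>x\<in>L. x)"
proof
  fix x
  have "\<phi> r3 = r3" using Gal_r3[OF assms(1), of 1 1] assms by simp
  hence "x \<in> L \<Longrightarrow> \<phi> x = x" using assms Gal_E[OF assms(1)] by (auto simp: mem_L)
  thus "\<phi> x = (\<lambda>x\<in>L. x) x" using assms(1) by (auto simp: mem_Gal_iff extensional_def)
qed

text \<open>Excludes \<tau> = id in a non-classical structure: the identity generates only itself,
  while r1 is also fixed by an automorphism that negates r2. The inverse case evaluates the definite
  description behind \<open>m_inv\<close>.\<close>

lemma generate_id: "generate (Gal L \<rat>) {\<lambda>x\<in>L. x} \<subseteq> {\<lambda>x\<in>L. x}"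
proof
  have id: "(\<lambda>x\<in>L. x) \<in> carrier (Gal L \<rat>)"
    using aut[of 1 1] Gal_eq_id by auto
  fix \<phi> assume "\<phi> \<in> generate (Gal L \<rat>) {\<lambda>x\<in>L. x}"
  thus "\<phi> \<in> {\<lambda>x\<in>L. x}"
  proof (induction rule: generate.induct)
    case (inv h)
    have "(THE y. y \<in> carrier (Gal L \<rat>) \<and> (\<lambda>x\<in>L. x) \<otimes>\<^bsub>Gal L \<rat>\<^esub> y = \<one>\<^bsub>Gal L \<rat>\<^esub> \<and>
        y \<otimes>\<^bsub>Gal L \<rat>\<^esub> (\<lambda>x\<in>L. x) = \<one>\<^bsub>Gal L \<rat>\<^esub>) = (\<lambda>x\<in>L. x)"
    proof (rule the_equality)
      fix y assume y: "y \<in> carrier (Gal L \<rat>) \<and> (\<lambda>x\<in>L. x) \<otimes>\<^bsub>Gal L \<rat>\<^esub> y = \<one>\<^bsub>Gal L \<rat>\<^esub> \<and>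
        y \<otimes>\<^bsub>Gal L \<rat>\<^esub> (\<lambda>x\<in>L. x) = \<one>\<^bsub>Gal L \<rat>\<^esub>"
      hence "compose L y (\<lambda>x\<in>L. x) = (\<lambda>x\<in>L. x)" using id by (metis mult_Gal one_Gal)
      hence "y x = x" if "x \<in> L" for x using that by (metis compose_eq restrict_apply)
      thus "y = (\<lambda>x\<in>L. x)" using y by (auto simp: mem_Gal_iff extensional_def restrict_def)
    qed (use id in \<open>auto simp: mult_Gal one_Gal compose_def restrict_def\<close>)
    thus ?case using inv by (simp add: m_inv_def)
  next
    case (eng h1 h2)
    thus ?case using id by (auto simp: mult_Gal compose_def restrict_def)
  qed (simp_all add: one_Gal)
qed

section \<open>The structure and its associated order as matrices\<close>

text \<open>On the plane this is the operator r + s w with w r2 = c3 r3 and w r3 = -c2 r2. Up to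
  sign, w is half of the basis element \<open>\<zeta> (\<sigma> - \<sigma>\<tau>)\<close>, which
  vanishes on Q + Q r1.\<close>

definition acts :: "(complex \<Rightarrow> complex) \<Rightarrow> rat \<Rightarrow> rat \<Rightarrow> rat \<Rightarrow> rat \<Rightarrow> bool" where
  "acts h p q r s \<longleftrightarrow> (\<forall>a0 a1 a2 a3. h (E a0 a1 a2 a3) =
     E (p * a0) (q * a1) (r * a2 - s * of_int c2 * a3) (r * a3 + s * of_int c3 * a2))"

lemma acts_unique:
  assumes "acts h p q r s" "acts h' p q r s" "h \<in> extensional L" "h' \<in> extensional L"
  shows "h = h'"
proof (rule extensionalityI[OF assms(3,4)])
  show "x \<in> L \<Longrightarrow> h x = h' x" for x using assms(1,2) by (auto simp: mem_L acts_def)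
qed

lemma acts_exists: "\<exists>h\<in>extensional L. acts h p q r s"
proof
  define f where "f a0 a1 a2 a3 = E (p * a0) (q * a1) (r * a2 - s * of_int c2 * a3) (r * a3 + s * of_int c3 * a2)"
    for a0 a1 a2 a3
  let ?h = "\<lambda>x\<in>L. THE y. \<exists>a0 a1 a2 a3. x = E a0 a1 a2 a3 \<and> y = f a0 a1 a2 a3"
  have "(THE y. \<exists>b0 b1 b2 b3. E a0 a1 a2 a3 = E b0 b1 b2 b3 \<and> y = f b0 b1 b2 b3) = f a0 a1 a2 a3"
    for a0 a1 a2 a3
    by (rule the_equality) (auto simp: E_inject)
  thus "acts ?h p q r s" by (simp add: acts_def flip: f_def)
qed simp

text \<open>\<tau> fixes r1 and negates r2 and r3; \<sigma> negates r1 and multiplies r2 by a sign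
  j, hence r3 by -j. So the coefficients (a, b, c, d) of the given basis act with (p, q, r, s) = (a
  + b + 2 c, a + b - 2 c, a - b, 2 j d), a change of coordinates invertible over Q. The result is
  the same for every choice of \<tau> and \<sigma>.\<close>

lemma nonclassical_HG_iff:
  assumes "nonclassical_HG L r1 H"
  shows "h \<in> H \<longleftrightarrow> h \<in> extensional L \<and> (\<exists>p q r s. acts h p q r s)"
proof -
  obtain \<tau> \<sigma> where \<tau>: "\<tau> \<in> carrier (Gal L (rat_adjoin {r1}))"
      and gen: "generate (Gal L \<rat>) {\<tau>} = carrier (Gal L (rat_adjoin {r1}))"
      and \<sigma>: "\<sigma> \<in> carrier (Gal L \<rat>)" "\<sigma> \<notin> carrier (Gal L (rat_adjoin {r1}))"
      and H: "H = HG_span L r1 \<tau> \<sigma>"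
    using assms by (auto simp: nonclassical_HG_def)
  have \<tau>1: "\<tau> \<in> carrier (Gal L \<rat>)" "\<tau> r1 = 1 * r1" using \<tau> by (auto simp: mem_Gal_r1_iff)
  obtain \<phi> where \<phi>: "\<phi> \<in> carrier (Gal L \<rat>)" "\<phi> r1 = r1" "\<phi> r2 = - r2"
    using aut[of 1 "- 1"] by auto
  have "\<tau> r2 \<noteq> r2"
  proof
    assume "\<tau> r2 = r2"
    hence "\<tau> = (\<lambda>x\<in>L. x)" using Gal_eq_id \<tau>1 by simp
    hence "\<phi> = (\<lambda>x\<in>L. x)" using gen generate_id \<phi> mem_Gal_r1_iff by blast
    hence "r2 = - r2" using \<phi>(3) by simp
    thus False using r_nonzero by simp
  qed
  hence \<tau>2: "\<tau> r2 = - 1 * r2" using Gal_r(2)[OF \<tau>1(1)] by auto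
  have \<sigma>1: "\<sigma> r1 = - 1 * r1" using Gal_r(1)[OF \<sigma>(1)] \<sigma> mem_Gal_r1_iff by auto
  \<comment> \<open>The sign is taken in the rationals so that it can be absorbed into the
    coordinates of \<open>elt\<close>.\<close>
  obtain j :: rat where j: "j * j = 1" "\<sigma> r2 = of_rat j * r2"
    using Gal_r(2)[OF \<sigma>(1)] by (metis mult_1 mult_minus1 mult_minus1_right minus_minus of_rat_1 of_rat_minus)
  have \<tau>E: "\<tau> (E a0 a1 a2 a3) = E a0 a1 (- a2) (- a3)" for a0 a1 a2 a3
    using Gal_E[OF \<tau>1(1)] Gal_r3[OF \<tau>1 \<tau>2] \<tau>1 \<tau>2 by (simp add: elt_def of_rat_minus)
  have \<sigma>E: "\<sigma> (E a0 a1 a2 a3) = E a0 (- a1) (j * a2) (- (j * a3))" for a0 a1 a2 a3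
    using Gal_E[OF \<sigma>(1)] Gal_r3[OF \<sigma>(1) \<sigma>1 j(2)] \<sigma>1 j(2) by (simp add: elt_def of_rat_minus of_rat_mult)
  define f where "f a b c d = (\<lambda>x\<in>L. of_rat a * x + of_rat b * \<tau> x + of_rat c * (\<sigma> x + \<sigma> (\<tau> x))
              + of_rat d * (r1 * (\<sigma> x - \<sigma> (\<tau> x))))" for a b c d
  have f: "acts (f a b c d) (a + b + 2 * c) (a + b - 2 * c) (a - b) (2 * j * d)" for a b c d
    unfolding acts_def
    by (auto simp: f_def \<tau>E \<sigma>E E_add E_diff E_mult_r1 E_scale E_inject algebra_simps)
  have H: "h \<in> H \<longleftrightarrow> (\<exists>a b c d. h = f a b c d)" for h
    by (auto simp: H HG_span_def f_def)
  show ?thesis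
  proof
    assume "h \<in> H"
    then obtain a b c d where h: "h = f a b c d" unfolding H by blast
    have "h \<in> extensional L" by (simp add: h f_def)
    with f[of a b c d] show "h \<in> extensional L \<and> (\<exists>p q r s. acts h p q r s)"
      unfolding h by blast
  next
    assume "h \<in> extensional L \<and> (\<exists>p q r s. acts h p q r s)"
    then obtain p q r s where h: "h \<in> extensional L" "acts h p q r s" by blast
    define a b c d where "a = (p + q) / 4 + r / 2" and "b = (p + q) / 4 - r / 2"
      and "c = (p - q) / 4" and "d = j * s / 2"
    let ?f = "f a b c d"
    have "a + b + 2 * c = p" "a + b - 2 * c = q" "a - b = r"
      by (simp_all add: a_def b_def c_def field_simps)
    moreover have "2 * j * d = s" using j(1) by (simp add: d_def flip: mult.assoc)
    ultimately have "acts ?f p q r s" using f[of a b c d] by simp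
    hence "h = ?f" using h by (intro acts_unique) (auto simp: f_def)
    thus "h \<in> H" unfolding H by blast
  qed
qed

lemma acts_Q:
  assumes "acts h (of_int p) (of_int q) (of_int r) (of_int s)"
  shows "h (Q u0 u1 u2 u3) = Q (p * u0) (q * u1) (r * u2 - s * c2 * u3) (r * u3 + s * c3 * u2)"
  using assms by (simp add: acts_def Q_def diff_divide_distrib add_divide_distrib)

lemma associated_order_iff:
  assumes H: "nonclassical_HG L r1 H"
  shows "h \<in> associated_order L H \<longleftrightarrow> h \<in> extensional L \<and>
    (\<exists>p q r s. ord_cond p q r s \<and> acts h (of_int p) (of_int q) (of_int r) (of_int s))"
proof
  assume "h \<in> associated_order L H"
  then obtain p q r s where h: "h \<in> extensional L" "acts h p q r s"
      and img: "h ` ring_of_integers L \<subseteq> ring_of_integers L"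
    by (auto simp: associated_order_def nonclassical_HG_iff[OF H])
  have "coprime c2 c3"
  proof (rule coprimeI)
    fix t assume "t dvd c2" "t dvd c3"
    hence "t * t dvd c2 * c3" by (rule mult_dvd_mono)
    hence "t\<^sup>2 dvd c1 * c2 * c3" by (simp add: power2_eq_square mult.assoc)
    thus "is_unit t" using sqf by (auto simp: squarefree_def)
  qed
  have "\<exists>P Q R S. p = of_int P \<and> q = of_int Q \<and> r = of_int R \<and> s = of_int S \<and> ord_cond P Q R S"
  proof (rule ord_cond_if_lat_image[OF e c_cong(2,3) \<open>coprime c2 c3\<close>])
    fix u0 u1 u2 u3 assume "lat e u0 u1 u2 u3"
    hence "Q u0 u1 u2 u3 \<in> ring_of_integers L" using ring_of_integers_iff by blast
    hence "h (Q u0 u1 u2 u3) \<in> ring_of_integers L" using img by blast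
    then obtain v0 v1 v2 v3 where v: "h (Q u0 u1 u2 u3) = Q v0 v1 v2 v3" "lat e v0 v1 v2 v3"
      using ring_of_integers_iff by blast
    have "of_int v0 = p * of_int u0 \<and> of_int v1 = q * of_int u1 \<and>
      of_int v2 = r * of_int u2 - s * of_int c2 * of_int u3 \<and>
      of_int v3 = r * of_int u3 + s * of_int c3 * of_int u2"
      using v(1) h(2) by (auto simp: acts_def Q_def E_inject field_simps)
    with v(2) show "\<exists>v0 v1 v2 v3. lat e v0 v1 v2 v3 \<and>
      of_int v0 = p * of_int u0 \<and> of_int v1 = q * of_int u1 \<and>
      of_int v2 = r * of_int u2 - s * of_int c2 * of_int u3 \<and>
      of_int v3 = r * of_int u3 + s * of_int c3 * of_int u2" by blast
  qed
  with h show "h \<in> extensional L \<and>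
    (\<exists>p q r s. ord_cond p q r s \<and> acts h (of_int p) (of_int q) (of_int r) (of_int s))" by blast
next
  assume "h \<in> extensional L \<and>
    (\<exists>p q r s. ord_cond p q r s \<and> acts h (of_int p) (of_int q) (of_int r) (of_int s))"
  then obtain p q r s where h: "h \<in> extensional L" "ord_cond p q r s"
    "acts h (of_int p) (of_int q) (of_int r) (of_int s)" by blast
  hence "h ` ring_of_integers L \<subseteq> ring_of_integers L"
    using lat_image[OF e c_cong(2,3) h(2)] by (auto simp: ring_of_integers_iff acts_Q[OF h(3)] Q_inject)
  with h show "h \<in> associated_order L H" by (auto simp: associated_order_def nonclassical_HG_iff[OF H])
qed

text \<open>Surjectivity is the solvability studied in \<open>lat_solve\<close> and
  \<open>lat_solve_imp\<close>; injectivity needs only that u0, u1 and the determinant on the plane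
  are nonzero.\<close>

theorem free_generator_iff:
  assumes H: "nonclassical_HG L r1 H"
  shows "free_generator (associated_order L H) (ring_of_integers L) \<beta> \<longleftrightarrow>
    (\<exists>u0 u1 u2 u3. \<beta> = Q u0 u1 u2 u3 \<and> lat e u0 u1 u2 u3 \<and> \<bar>u0\<bar> = 1 \<and> \<bar>u1\<bar> = 1 \<and>
      \<bar>c3 * u2\<^sup>2 + c2 * u3\<^sup>2\<bar> = 2)"
proof
  assume *: "free_generator (associated_order L H) (ring_of_integers L) \<beta>"
  then obtain u0 u1 u2 u3 where u: "\<beta> = Q u0 u1 u2 u3" "lat e u0 u1 u2 u3"
    by (auto simp: free_generator_def ring_of_integers_iff)
  have "\<exists>p q r s. ord_cond p q r s \<and> v0 = p * u0 \<and> v1 = q * u1 \<and>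
    v2 = r * u2 - s * c2 * u3 \<and> v3 = r * u3 + s * c3 * u2" if "lat e v0 v1 v2 v3" for v0 v1 v2 v3
  proof -
    have "Q v0 v1 v2 v3 \<in> ring_of_integers L" using that ring_of_integers_iff by blast
    then obtain h where "h \<in> associated_order L H" "Q v0 v1 v2 v3 = h \<beta>"
      using * by (auto simp: free_generator_def bij_betw_def)
    thus ?thesis unfolding associated_order_iff[OF H] u by (metis acts_Q Q_inject)
  qed
  from lat_solve_imp[OF e c_cong(2,3) u(2) this] u
  show "\<exists>u0 u1 u2 u3. \<beta> = Q u0 u1 u2 u3 \<and> lat e u0 u1 u2 u3 \<and> \<bar>u0\<bar> = 1 \<and> \<bar>u1\<bar> = 1 \<and>
      \<bar>c3 * u2\<^sup>2 + c2 * u3\<^sup>2\<bar> = 2" by blast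
next
  assume "\<exists>u0 u1 u2 u3. \<beta> = Q u0 u1 u2 u3 \<and> lat e u0 u1 u2 u3 \<and> \<bar>u0\<bar> = 1 \<and> \<bar>u1\<bar> = 1 \<and>
      \<bar>c3 * u2\<^sup>2 + c2 * u3\<^sup>2\<bar> = 2"
  then obtain u0 u1 u2 u3 where \<beta>: "\<beta> = Q u0 u1 u2 u3"
    and u: "lat e u0 u1 u2 u3" "\<bar>u0\<bar> = 1" "\<bar>u1\<bar> = 1" "\<bar>c3 * u2\<^sup>2 + c2 * u3\<^sup>2\<bar> = 2" by blast
  have \<beta>O: "\<beta> \<in> ring_of_integers L" using \<beta> u ring_of_integers_iff by blast
  have "inj_on (\<lambda>h. h \<beta>) (associated_order L H)"
  proof (rule inj_onI)
    fix h h' assume "h \<in> associated_order L H" "h' \<in> associated_order L H" and eq: "h \<beta> = h' \<beta>"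
    then obtain p q r s p' q' r' s' where h: "h \<in> extensional L" "h' \<in> extensional L"
      "acts h (of_int p) (of_int q) (of_int r) (of_int s)"
      "acts h' (of_int p') (of_int q') (of_int r') (of_int s')"
      by (auto simp: associated_order_iff[OF H])
    from eq have *: "p * u0 = p' * u0" "q * u1 = q' * u1" "r * u2 - s * c2 * u3 = r' * u2 - s' * c2 * u3"
        "r * u3 + s * c3 * u2 = r' * u3 + s' * c3 * u2"
      unfolding \<beta> acts_Q[OF h(3)] acts_Q[OF h(4)] Q_inject by blast+
    define x y where "x = r - r'" and "y = s - s'"
    have xy: "x * u2 - y * c2 * u3 = 0" "x * u3 + y * c3 * u2 = 0"
      using *(3,4) unfolding x_def y_def by (simp_all add: algebra_simps)
    \<comment> \<open>The adjugate matrix is applied to the homogeneous system for the differences x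
      and y.\<close>
    have "(c3 * u2\<^sup>2 + c2 * u3\<^sup>2) * x = c3 * u2 * (x * u2 - y * c2 * u3) + c2 * u3 * (x * u3 + y * c3 * u2)"
      "(c3 * u2\<^sup>2 + c2 * u3\<^sup>2) * y = u2 * (x * u3 + y * c3 * u2) - u3 * (x * u2 - y * c2 * u3)"
      by (simp_all add: algebra_simps power2_eq_square)
    hence "(c3 * u2\<^sup>2 + c2 * u3\<^sup>2) * x = 0" "(c3 * u2\<^sup>2 + c2 * u3\<^sup>2) * y = 0"
      unfolding xy by simp_all
    hence "x = 0" "y = 0" using u(4) by auto
    hence "p = p'" "q = q'" "r = r'" "s = s'" using *(1,2) u(2,3) unfolding x_def y_def by auto
    with h show "h = h'" using acts_unique by blast
  qed
  moreover have "(\<lambda>h. h \<beta>) ` associated_order L H = ring_of_integers L"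
  proof
    show "(\<lambda>h. h \<beta>) ` associated_order L H \<subseteq> ring_of_integers L"
      using \<beta>O by (auto simp: associated_order_def)
    show "ring_of_integers L \<subseteq> (\<lambda>h. h \<beta>) ` associated_order L H"
    proof
      fix x assume "x \<in> ring_of_integers L"
      then obtain v0 v1 v2 v3 where x: "x = Q v0 v1 v2 v3" and v: "lat e v0 v1 v2 v3"
        unfolding ring_of_integers_iff by blast
      obtain p q r s where pqrs: "ord_cond p q r s" "v0 = p * u0" "v1 = q * u1"
          "v2 = r * u2 - s * c2 * u3" "v3 = r * u3 + s * c3 * u2"
        using lat_solve[OF e c_cong(2,3) u v] by blast
      obtain h where h: "h \<in> extensional L" "acts h (of_int p) (of_int q) (of_int r) (of_int s)"
        using acts_exists by blast
      have "h \<in> associated_order L H" using pqrs(1) h unfolding associated_order_iff[OF H] by blast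
      moreover have "h \<beta> = x" unfolding \<beta> x acts_Q[OF h(2)] pqrs(2-5) ..
      ultimately show "x \<in> (\<lambda>h. h \<beta>) ` associated_order L H" by blast
    qed
  qed
  ultimately show "free_generator (associated_order L H) (ring_of_integers L) \<beta>"
    using \<beta>O by (simp add: free_generator_def bij_betw_def)
qed

theorem free_of_rank_one_iff:
  assumes H: "nonclassical_HG L r1 H"
  shows "free_of_rank_one (associated_order L H) (ring_of_integers L) \<longleftrightarrow>
    (\<exists>u2 u3. \<bar>c3 * u2\<^sup>2 + c2 * u3\<^sup>2\<bar> = 2)"
proof
  assume "\<exists>u2 u3. \<bar>c3 * u2\<^sup>2 + c2 * u3\<^sup>2\<bar> = 2"
  then obtain u2 u3 where D: "\<bar>c3 * u2\<^sup>2 + c2 * u3\<^sup>2\<bar> = 2" by blast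
  have odd: "odd u2 \<and> odd u3" by (rule odd_if_abs_form_eq_2[OF odd_c(3,2) D])
  \<comment> \<open>With u0 = 1 the lattice condition reads 4 | 1 + e u1 + e (u2 + u3). As u2 + u3
    is even, exactly one sign of u1 achieves it.\<close>
  define u1 where "u1 = (if 4 dvd u2 + u3 then - e else e)"
  have "lat e 1 u1 u2 u3"
    using e odd unfolding lat_def u1_def by (elim disjE) (simp_all, presburger+)
  moreover have "\<bar>u1\<bar> = 1" using e by (auto simp: u1_def)
  ultimately show "free_of_rank_one (associated_order L H) (ring_of_integers L)"
    unfolding free_of_rank_one_def free_generator_iff[OF H] using D by (metis abs_one)
qed (auto simp: free_of_rank_one_def free_generator_iff[OF H])

end

subsection \<open>Coordinates of a biquadratic field\<close>

lemma rat_adjoin_closed: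
  "x \<in> rat_adjoin S \<Longrightarrow> y \<in> rat_adjoin S \<Longrightarrow> x + y \<in> rat_adjoin S"
  "x \<in> rat_adjoin S \<Longrightarrow> y \<in> rat_adjoin S \<Longrightarrow> x * y \<in> rat_adjoin S"
  "x \<in> rat_adjoin S \<Longrightarrow> - x \<in> rat_adjoin S"
  "x \<in> rat_adjoin S \<Longrightarrow> x \<noteq> 0 \<Longrightarrow> inverse x \<in> rat_adjoin S"
  using generate_field.eng_add[of x complex_ring _ y] generate_field.eng_mult[of x complex_ring _ y]
    generate_field.a_inv[of x complex_ring] generate_field.m_inv[of x complex_ring]
  by (auto simp: rat_adjoin_def complex_ring_simps complex_ring_minus complex_ring_inverse)

lemma Gal_eqI:
  assumes \<phi>: "\<phi> \<in> carrier (Gal (rat_adjoin S) \<rat>)" and \<psi>: "\<psi> \<in> carrier (Gal (rat_adjoin S) \<rat>)"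
    and gen: "\<And>s. s \<in> S \<Longrightarrow> \<phi> s = \<psi> s"
  shows "\<phi> = \<psi>"
proof (rule extensionalityI)
  show "\<phi> \<in> extensional (rat_adjoin S)" "\<psi> \<in> extensional (rat_adjoin S)"
    using \<phi> \<psi> by (simp_all add: mem_Gal_iff)
  fix x assume "x \<in> rat_adjoin S"
  \<comment> \<open>Membership is carried through the induction because the homomorphism laws hold
    only on the field.\<close>
  hence "x \<in> rat_adjoin S \<and> \<phi> x = \<psi> x"
  proof (induction rule: rat_adjoin_induct)
    case (rat a)
    show ?case using \<phi> \<psi> by (simp add: mem_Gal_iff rat_adjoin_mem)
  next
    case (gen s)
    thus ?case using assms(3) by (simp add: rat_adjoin_mem)
  next
    case (minus x)
    have "(- 1 :: complex) \<in> rat_adjoin S" using rat_adjoin_mem(1)[of "- 1" S] by (simp add: of_rat_minus)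
    moreover have "(- 1 :: complex) \<in> \<rat>" by simp
    ultimately have "\<theta> (- x) = - \<theta> x" if "\<theta> \<in> carrier (Gal (rat_adjoin S) \<rat>)" for \<theta>
      using that minus by (metis mem_Gal_iff mult_minus1)
    from this[OF \<phi>] this[OF \<psi>] minus show ?case by (simp add: rat_adjoin_closed)
  next
    case (inverse x)
    have "\<theta> x * \<theta> (inverse x) = 1" if "\<theta> \<in> carrier (Gal (rat_adjoin S) \<rat>)" for \<theta>
      using that inverse by (metis mem_Gal_iff rat_adjoin_closed(4) right_inverse)
    from this[OF \<phi>] this[OF \<psi>] inverse show ?case
      by (metis inverse_unique rat_adjoin_closed(4))
  next
    case (add x y)
    thus ?case using \<phi> \<psi> by (simp add: mem_Gal_iff rat_adjoin_closed)
  next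
    case (mult x y)
    thus ?case using \<phi> \<psi> by (simp add: mem_Gal_iff rat_adjoin_closed)
  qed
  thus "\<phi> x = \<psi> x" by simp
qed

lemma card_Gal_biquadratic: "biquadratic L \<Longrightarrow> card (carrier (Gal L \<rat>)) = 4"
  by (auto simp: biquadratic_def carrier_integer_mod_group card_cartesian_product dest!: iso_same_card)

text \<open>A count: an automorphism is determined by which of r1, r2 it fixes, and there are four
  automorphisms, so all four patterns occur.\<close>

lemma biquadratic_aut:
  assumes L: "L = rat_adjoin {r1, r2}" "biquadratic L"
    and sq: "r1\<^sup>2 \<in> \<rat>" "r2\<^sup>2 \<in> \<rat>"
    and ij: "i\<^sup>2 = 1" "j\<^sup>2 = 1"
  shows "\<exists>\<phi>\<in>carrier (Gal L \<rat>). \<phi> r1 = i * r1 \<and> \<phi> r2 = j * r2"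
proof -
  have r: "\<phi> s = s \<or> \<phi> s = - s" if "\<phi> \<in> carrier (Gal L \<rat>)" "s \<in> {r1, r2}" for \<phi> s
  proof -
    have "s \<in> L" using that(2) by (auto simp: L intro: rat_adjoin_mem)
    hence "(\<phi> s)\<^sup>2 = \<phi> (s\<^sup>2)" using that(1) by (simp add: mem_Gal_iff power2_eq_square)
    also have "\<dots> = s\<^sup>2" using that sq by (auto simp: mem_Gal_iff)
    finally show ?thesis by (simp add: power2_eq_iff)
  qed
  define f where "f \<phi> = (\<phi> r1 = r1, \<phi> r2 = r2)" for \<phi>
  have "inj_on f (carrier (Gal L \<rat>))"
  proof (rule inj_onI)
    fix \<phi> \<psi> assume *: "\<phi> \<in> carrier (Gal L \<rat>)" "\<psi> \<in> carrier (Gal L \<rat>)" "f \<phi> = f \<psi>"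
    hence "\<phi> s = \<psi> s" if "s \<in> {r1, r2}" for s
      using that r[OF *(1) that] r[OF *(2) that] by (auto simp: f_def)
    thus "\<phi> = \<psi>" using * Gal_eqI unfolding L(1) by blast
  qed
  hence "card (f ` carrier (Gal L \<rat>)) = 4"
    using card_Gal_biquadratic[OF L(2)] by (simp add: card_image)
  also have "4 = card (UNIV :: (bool \<times> bool) set)"
    by (simp add: card_UNIV_bool card_cartesian_product flip: UNIV_Times_UNIV)
  finally have "f ` carrier (Gal L \<rat>) = UNIV"
    by (intro card_subset_eq) auto
  \<comment> \<open>If a root is 0, every automorphism fixes it and both signs agree on it; the
    extra disjuncts cover this case.\<close>
  then obtain \<phi> where \<phi>: "\<phi> \<in> carrier (Gal L \<rat>)" "f \<phi> = (i = 1 \<or> r1 = 0, j = 1 \<or> r2 = 0)"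
    by (metis UNIV_I imageE)
  moreover have "i = 1 \<or> i = - 1" "j = 1 \<or> j = - 1" using ij by (auto simp: power2_eq_1_iff)
  ultimately show ?thesis using r[OF \<phi>(1), of r1] r[OF \<phi>(1), of r2]
    by (intro bexI[of _ \<phi>]) (auto simp: f_def)
qed

lemma elt_mult:
  assumes "r1 * r2 = of_int c3 * r3" "r2 * r3 = of_int c1 * r1" "r3 * r1 = of_int c2 * r2"
    and "r1\<^sup>2 = of_int (c2 * c3)" "r2\<^sup>2 = of_int (c3 * c1)" "r3\<^sup>2 = of_int (c1 * c2)"
  shows "elt r1 r2 r3 a0 a1 a2 a3 * elt r1 r2 r3 b0 b1 b2 b3 =
    elt r1 r2 r3 (a0 * b0 + of_int (c2 * c3) * (a1 * b1) + of_int (c3 * c1) * (a2 * b2) + of_int (c1 * c2) * (a3 * b3))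
      (a0 * b1 + a1 * b0 + of_int c1 * (a2 * b3 + a3 * b2))
      (a0 * b2 + a2 * b0 + of_int c2 * (a3 * b1 + a1 * b3))
      (a0 * b3 + a3 * b0 + of_int c3 * (a1 * b2 + a2 * b1))" (is "?l = ?r")
proof -
  let ?q = "of_rat :: rat \<Rightarrow> complex"
  have "?l = ?q a0 * ?q b0 + ?q a1 * ?q b1 * r1\<^sup>2 + ?q a2 * ?q b2 * r2\<^sup>2 + ?q a3 * ?q b3 * r3\<^sup>2
    + (?q a0 * ?q b1 + ?q a1 * ?q b0) * r1 + (?q a2 * ?q b3 + ?q a3 * ?q b2) * (r2 * r3)
    + (?q a0 * ?q b2 + ?q a2 * ?q b0) * r2 + (?q a3 * ?q b1 + ?q a1 * ?q b3) * (r3 * r1)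
    + (?q a0 * ?q b3 + ?q a3 * ?q b0) * r3 + (?q a1 * ?q b2 + ?q a2 * ?q b1) * (r1 * r2)"
    by (simp add: elt_def algebra_simps power2_eq_square)
  also have "\<dots> = ?r"
    unfolding assms by (simp add: elt_def of_rat_add of_rat_mult algebra_simps)
  finally show ?thesis .
qed

lemma elt_eq_0_biquadratic:
  assumes L: "L = rat_adjoin {r1, r2}" "biquadratic L"
    and sq: "r1\<^sup>2 \<in> \<rat>" "r2\<^sup>2 \<in> \<rat>" and c: "r1 * r2 = of_int c * r3" "c \<noteq> 0"
    and nz: "r1 \<noteq> 0" "r2 \<noteq> 0" and 0: "elt r1 r2 r3 a0 a1 a2 a3 = 0"
  shows "a0 = 0 \<and> a1 = 0 \<and> a2 = 0 \<and> a3 = 0"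
proof -
  have eq: "elt (i * r1) (j * r2) (i * j * r3) a0 a1 a2 a3 = 0" if ij: "i\<^sup>2 = 1" "j\<^sup>2 = 1" for i j
  proof -
    obtain \<phi> where \<phi>: "\<phi> \<in> carrier (Gal L \<rat>)" "\<phi> r1 = i * r1" "\<phi> r2 = j * r2"
      using biquadratic_aut[OF L sq ij] by blast
    have mem: "r1 \<in> L" "r2 \<in> L" "of_rat a \<in> L" for a by (auto simp: L intro: rat_adjoin_mem)
    have cl: "x + y \<in> L" "x * y \<in> L" if "x \<in> L" "y \<in> L" for x y
      using that rat_adjoin_closed by (auto simp: L)
    have hom: "\<phi> (x + y) = \<phi> x + \<phi> y" "\<phi> (x * y) = \<phi> x * \<phi> y" if "x \<in> L" "y \<in> L" for x y
      using that \<phi>(1) by (auto simp: mem_Gal_iff)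
    have rat: "\<phi> (of_rat a) = of_rat a" for a using \<phi>(1) by (simp add: mem_Gal_iff)
    have r3: "r3 = of_rat (1 / of_int c) * (r1 * r2)" using c by (simp add: of_rat_divide)
    have "\<phi> r3 = of_rat (1 / of_int c) * (i * r1 * (j * r2))"
      unfolding r3 by (simp only: hom mem cl rat \<phi>)
    also have "\<dots> = i * j * r3" unfolding r3 by (simp add: ac_simps)
    finally have "\<phi> r3 = i * j * r3" .
    moreover have "r3 \<in> L" unfolding r3 by (intro cl mem)
    ultimately have "\<phi> (elt r1 r2 r3 a0 a1 a2 a3) = elt (i * r1) (j * r2) (i * j * r3) a0 a1 a2 a3"
      unfolding elt_def by (simp only: hom mem cl rat \<phi>)
    thus ?thesis using rat[of 0] unfolding 0 by simp
  qed
  let ?F = "\<lambda>i j. elt (i * r1) (j * r2) (i * j * r3) a0 a1 a2 a3"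
  have F: "?F 1 1 = 0" "?F 1 (- 1) = 0" "?F (- 1) 1 = 0" "?F (- 1) (- 1) = 0"
    by (rule eq; simp)+
  \<comment> \<open>Orthogonality of the four characters of the sign group isolates each summand
    from the four conjugates.\<close>
  have "4 * of_rat a0 = ?F 1 1 + ?F 1 (- 1) + ?F (- 1) 1 + ?F (- 1) (- 1)"
    "4 * (of_rat a1 * r1) = ?F 1 1 + ?F 1 (- 1) - ?F (- 1) 1 - ?F (- 1) (- 1)"
    "4 * (of_rat a2 * r2) = ?F 1 1 - ?F 1 (- 1) + ?F (- 1) 1 - ?F (- 1) (- 1)"
    "4 * (of_rat a3 * r3) = ?F 1 1 - ?F 1 (- 1) - ?F (- 1) 1 + ?F (- 1) (- 1)"
    by (simp_all add: elt_def)
  hence "of_rat a0 = (0 :: complex)" "of_rat a1 * r1 = 0" "of_rat a2 * r2 = 0" "of_rat a3 * r3 = 0"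
    unfolding F by simp_all
  moreover have "r3 \<noteq> 0" using c nz by auto
  ultimately show ?thesis using nz by simp
qed

lemma mem_rat_adjoin_iff_elt:
  assumes rels: "r1 * r2 = of_int c3 * r3" "r2 * r3 = of_int c1 * r1" "r3 * r1 = of_int c2 * r2"
      "r1\<^sup>2 = of_int (c2 * c3)" "r2\<^sup>2 = of_int (c3 * c1)" "r3\<^sup>2 = of_int (c1 * c2)"
    and c3: "c3 \<noteq> 0"
    and indep: "\<And>a0 a1 a2 a3. elt r1 r2 r3 a0 a1 a2 a3 = 0 \<Longrightarrow> a0 = 0 \<and> a1 = 0 \<and> a2 = 0 \<and> a3 = 0"
  shows "x \<in> rat_adjoin {r1, r2} \<longleftrightarrow> (\<exists>a0 a1 a2 a3. x = elt r1 r2 r3 a0 a1 a2 a3)"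
proof
  note mult = elt_mult[OF rels]
  assume "x \<in> rat_adjoin {r1, r2}"
  thus "\<exists>a0 a1 a2 a3. x = elt r1 r2 r3 a0 a1 a2 a3"
  proof (induction rule: rat_adjoin_induct)
    case (rat a)
    have "of_rat a = elt r1 r2 r3 a 0 0 0" by (simp add: elt_def)
    thus ?case by blast
  next
    case (gen s)
    moreover have "r1 = elt r1 r2 r3 0 1 0 0" "r2 = elt r1 r2 r3 0 0 1 0" by (simp_all add: elt_def)
    ultimately show ?case by blast
  next
    case (minus x)
    then obtain a0 a1 a2 a3 where "x = elt r1 r2 r3 a0 a1 a2 a3" by blast
    hence "- x = elt r1 r2 r3 (- a0) (- a1) (- a2) (- a3)" by (simp add: elt_def of_rat_minus)
    thus ?case by blast
  next
    case (inverse x)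
    then obtain a0 a1 a2 a3 where x: "x = elt r1 r2 r3 a0 a1 a2 a3" by blast
    \<comment> \<open>Inversion by two successive norms: x' is the conjugate of x over Q(r1), so x
      x' = A + B r1; y is the conjugate of that over Q, and N is the full norm.\<close>
    define x' where "x' = elt r1 r2 r3 a0 a1 (- a2) (- a3)"
    define A B where "A = a0\<^sup>2 + of_int (c2 * c3) * a1\<^sup>2 - of_int (c3 * c1) * a2\<^sup>2 - of_int (c1 * c2) * a3\<^sup>2"
      and "B = 2 * a0 * a1 - 2 * of_int c1 * (a2 * a3)"
    define y where "y = elt r1 r2 r3 A (- B) 0 0"
    define N where "N = A\<^sup>2 - of_int (c2 * c3) * B\<^sup>2"
    have xx': "x * x' = elt r1 r2 r3 A B 0 0"
      unfolding x x'_def mult A_def B_def by (simp add: power2_eq_square algebra_simps)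
    have "x * (x' * y) = elt r1 r2 r3 A B 0 0 * y" by (simp flip: xx' mult.assoc)
    also have "\<dots> = elt r1 r2 r3 N 0 0 0"
      unfolding y_def mult N_def by (simp add: power2_eq_square algebra_simps)
    also have "\<dots> = of_rat N" by (simp add: elt_def)
    finally have N: "x * (x' * y) = of_rat N" .
    have "x' \<noteq> 0" using indep[of a0 a1 "- a2" "- a3"] inverse(2) unfolding x x'_def by (auto simp: elt_def)
    hence "elt r1 r2 r3 A B 0 0 \<noteq> 0" using inverse(2) by (simp flip: xx')
    hence "y \<noteq> 0" using indep[of A "- B" 0 0] unfolding y_def by (auto simp: elt_def)
    with \<open>x' \<noteq> 0\<close> inverse(2) N have "of_rat N \<noteq> (0 :: complex)" by (metis mult_eq_0_iff)
    hence "inverse x = of_rat (1 / N) * (x' * y)"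
      using N inverse(2) by (simp add: of_rat_divide field_simps)
    also have "of_rat (1 / N) = elt r1 r2 r3 (1 / N) 0 0 0" by (simp add: elt_def)
    finally show ?case unfolding x'_def y_def mult by blast
  next
    case (add x y)
    then obtain a0 a1 a2 a3 b0 b1 b2 b3 where "x = elt r1 r2 r3 a0 a1 a2 a3" "y = elt r1 r2 r3 b0 b1 b2 b3" by blast
    hence "x + y = elt r1 r2 r3 (a0 + b0) (a1 + b1) (a2 + b2) (a3 + b3)"
      by (simp add: elt_def of_rat_add algebra_simps)
    thus ?case by blast
  next
    case (mult x y)
    thus ?case using elt_mult[OF rels] by blast
  qed
next
  have "r3 = of_rat (1 / of_int c3) * (r1 * r2)" using rels(1) c3 by (simp add: of_rat_divide)
  hence "r3 \<in> rat_adjoin {r1, r2}" by (simp add: rat_adjoin_closed rat_adjoin_mem)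
  moreover have "r1 \<in> rat_adjoin {r1, r2}" "r2 \<in> rat_adjoin {r1, r2}" by (simp_all add: rat_adjoin_mem)
  ultimately show "\<exists>a0 a1 a2 a3. x = elt r1 r2 r3 a0 a1 a2 a3 \<Longrightarrow> x \<in> rat_adjoin {r1, r2}"
    unfolding elt_def by (elim exE) (simp only: rat_adjoin_closed rat_adjoin_mem)
qed

text \<open>Every unit modulo 4 is its own inverse, so a and b are both congruent to c. Applied with
  c = d, where the products are n and m, it yields the common sign e.\<close>

lemma cong_mod_4_of_products:
  fixes a b c :: int
  assumes "[c * a = 1] (mod 4)" "[c * b = 1] (mod 4)"
  shows "\<exists>e. (e = 1 \<or> e = - 1) \<and> 4 dvd a - e \<and> 4 dvd b - e \<and> 4 dvd c - e"
proof -
  have *: "x mod 4 = c mod 4 \<and> (c mod 4 = 1 \<or> c mod 4 = 3)" if "[c * x = 1] (mod 4)" for x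
  proof -
    have "((c mod 4) * (x mod 4)) mod 4 = 1" using that by (simp add: cong_def mod_mult_eq)
    moreover have "c mod 4 \<in> {0, 1, 2, 3}" "x mod 4 \<in> {0, 1, 2, 3}" by auto
    ultimately show ?thesis by auto
  qed
  note ** = *[OF assms(1)] *[OF assms(2)]
  hence "(4 dvd a - 1 \<and> 4 dvd b - 1 \<and> 4 dvd c - 1) \<or> (4 dvd a - - 1 \<and> 4 dvd b - - 1 \<and> 4 dvd c - - 1)"
    by presburger
  thus ?thesis by blast
qed

text \<open>The product (n/d) (m/d) d is n (m/d), whose factors are squarefree. They are coprime:
  m/d is prime to n/d by the choice of d, and prime to d because the square of a common divisor
  would divide m.\<close>

lemma klein_biquadratic:
  fixes m n d :: int
  assumes sqf: "squarefree m" "squarefree n" and cong: "[m = 1] (mod 4)" "[n = 1] (mod 4)"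
    and d: "d = gcd m n"
    and r: "rm\<^sup>2 = of_int m" "rn\<^sup>2 = of_int n" "rk = rm * rn / of_int d"
    and L: "L = rat_adjoin {rm, rn}" "biquadratic L"
  shows "\<exists>e. klein (n div d) (m div d) d e rm rn rk L"
proof -
  define m' n' where "m' = m div d" and "n' = n div d"
  have nz: "m \<noteq> 0" "n \<noteq> 0" using cong by (auto simp: cong_def)
  have "d > 0" using nz d by auto
  have m: "m = d * m'" and n: "n = d * n'" using d by (auto simp: m'_def n'_def)
  have "coprime m' n'" unfolding m'_def n'_def d using nz by (intro div_gcd_coprime) auto
  obtain e where e: "e = 1 \<or> e = - 1" "4 dvd n' - e" "4 dvd m' - e" "4 dvd d - e"
    using cong_mod_4_of_products[of d n' m'] cong m n by auto
  have "coprime d m'"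
  proof (rule coprimeI)
    fix t assume "t dvd d" "t dvd m'"
    hence "t * t dvd m" unfolding m by (rule mult_dvd_mono)
    thus "is_unit t" using squarefreeD[OF sqf(1)] by (simp only: power2_eq_square)
  qed
  hence "coprime n m'" using \<open>coprime m' n'\<close> by (simp add: n coprime_commute)
  moreover have "squarefree m'" using sqf(1) by (rule squarefree_mono[rotated]) (simp add: m)
  ultimately have sq: "squarefree (n' * m' * d)"
    using squarefree_mult_coprime[of n m'] sqf(2) by (simp add: n ac_simps)
  have rels: "rm * rn = of_int d * rk" "rn * rk = of_int n' * rm" "rk * rm = of_int m' * rn"
    "rm\<^sup>2 = of_int (m' * d)" "rn\<^sup>2 = of_int (d * n')" "rk\<^sup>2 = of_int (n' * m')"
  proof -
    show 1: "rm * rn = of_int d * rk" using r(3) \<open>d > 0\<close> by simp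
    show 2: "rm\<^sup>2 = of_int (m' * d)" "rn\<^sup>2 = of_int (d * n')"
      unfolding r(1,2) m n by (simp_all add: mult.commute)
    have "of_int d * (rn * rk) = rn\<^sup>2 * rm" "of_int d * (rk * rm) = rm\<^sup>2 * rn"
      using 1 by (simp_all add: power2_eq_square ac_simps)
    hence "of_int d * (rn * rk) = of_int d * (of_int n' * rm)" "of_int d * (rk * rm) = of_int d * (of_int m' * rn)"
      unfolding 2 by simp_all
    thus 3: "rn * rk = of_int n' * rm" "rk * rm = of_int m' * rn" using \<open>d > 0\<close> by simp_all
    have "of_int d * rk\<^sup>2 = (rk * rm) * rn"
      using 1 by (simp add: power2_eq_square ac_simps)
    also have "\<dots> = of_int m' * rn\<^sup>2" unfolding 3 by (simp add: power2_eq_square)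
    also have "\<dots> = of_int d * of_int (n' * m')" unfolding 2 by simp
    finally have "of_int d * rk\<^sup>2 = of_int d * of_int (n' * m')" .
    thus "rk\<^sup>2 = of_int (n' * m')" using \<open>d > 0\<close> by simp
  qed
  have rat: "rm\<^sup>2 \<in> \<rat>" "rn\<^sup>2 \<in> \<rat>" unfolding r(1,2) by simp_all
  have "rm \<noteq> 0" "rn \<noteq> 0" using r(1,2) nz by auto
  hence indep: "elt rm rn rk a0 a1 a2 a3 = 0 \<Longrightarrow> a0 = 0 \<and> a1 = 0 \<and> a2 = 0 \<and> a3 = 0" for a0 a1 a2 a3
    using elt_eq_0_biquadratic[OF L rat rels(1)] \<open>d > 0\<close> by blast
  have "klein n' m' d e rm rn rk L"
  proof
    show "x \<in> L \<longleftrightarrow> (\<exists>a0 a1 a2 a3. x = elt rm rn rk a0 a1 a2 a3)" for x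
      unfolding L(1) using mem_rat_adjoin_iff_elt[OF rels] indep \<open>d > 0\<close> by blast
    show "\<exists>\<phi>\<in>carrier (Gal L \<rat>). \<phi> rm = i * rm \<and> \<phi> rn = j * rn" if "i\<^sup>2 = 1" "j\<^sup>2 = 1" for i j
      by (rule biquadratic_aut[OF L rat that])
  qed (use e sq rels indep in blast)+
  thus ?thesis unfolding m'_def n'_def by blast
qed

section \<open>From the determinant form to the equations and generators\<close>

text \<open>With a = h g, x = t g and h prime to t, the factor h divides g, so h^2 divides a and h
  is a unit.\<close>

lemma squarefree_dvd_square_imp_dvd:
  fixes a x :: int
  assumes "squarefree a" "a dvd x\<^sup>2"
  shows "a dvd x"
proof -
  define g where "g = gcd a x"
  have "a \<noteq> 0" using assms(1) by auto
  hence g: "g \<noteq> 0" by (simp add: g_def)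
  obtain h t where ht: "a = h * g" "x = t * g" "coprime h t"
    using gcd_coprime_exists[of a x] \<open>a \<noteq> 0\<close> unfolding g_def by auto
  have "g * h dvd g * (g * t\<^sup>2)" using assms(2) unfolding ht by (simp add: power2_eq_square ac_simps)
  hence "h dvd g * t\<^sup>2" using g by simp
  hence "h dvd g" using ht(3) by (simp add: coprime_dvd_mult_left_iff)
  hence "h\<^sup>2 dvd a" unfolding ht(1) power2_eq_square by simp
  hence "is_unit h" using assms(1) by (auto simp: squarefree_def)
  hence "h dvd t" by (rule unit_imp_dvd)
  thus ?thesis unfolding ht(1,2) by (rule mult_dvd_mono) simp
qed

text \<open>The equation makes a divide x^2, hence x, and a factor a cancels. The quotient u = x / a
  is kept, since it is a coordinate of the generator.\<close>

lemma square_add_eq_iff_form: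
  fixes a b x y :: int
  assumes "squarefree a"
  shows "(x\<^sup>2 + a * b * y\<^sup>2 = 2 * a \<or> x\<^sup>2 + a * b * y\<^sup>2 = - (2 * a)) \<longleftrightarrow>
    (\<exists>u. x = a * u \<and> \<bar>a * u\<^sup>2 + b * y\<^sup>2\<bar> = 2)"
proof
  assume *: "x\<^sup>2 + a * b * y\<^sup>2 = 2 * a \<or> x\<^sup>2 + a * b * y\<^sup>2 = - (2 * a)"
  hence "x\<^sup>2 = a * (2 - b * y\<^sup>2) \<or> x\<^sup>2 = a * (- 2 - b * y\<^sup>2)" by (auto simp: algebra_simps)
  hence "a dvd x\<^sup>2" by (metis dvd_triv_left)
  hence "a dvd x" using assms squarefree_dvd_square_imp_dvd by blast
  then obtain u where u: "x = a * u" by blast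
  have "a \<noteq> 0" using assms by auto
  from * have "a * (a * u\<^sup>2 + b * y\<^sup>2) = a * 2 \<or> a * (a * u\<^sup>2 + b * y\<^sup>2) = a * (- 2)"
    unfolding u by (simp add: power2_eq_square algebra_simps)
  with \<open>a \<noteq> 0\<close> have "a * u\<^sup>2 + b * y\<^sup>2 = 2 \<or> a * u\<^sup>2 + b * y\<^sup>2 = - 2" by (simp only: mult_cancel_left) simp
  hence "\<bar>a * u\<^sup>2 + b * y\<^sup>2\<bar> = 2" by linarith
  with u show "\<exists>u. x = a * u \<and> \<bar>a * u\<^sup>2 + b * y\<^sup>2\<bar> = 2" by blast
next
  assume "\<exists>u. x = a * u \<and> \<bar>a * u\<^sup>2 + b * y\<^sup>2\<bar> = 2"
  then obtain u where u: "x = a * u" "\<bar>a * u\<^sup>2 + b * y\<^sup>2\<bar> = 2" by blast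
  have "x\<^sup>2 + a * b * y\<^sup>2 = a * (a * u\<^sup>2 + b * y\<^sup>2)" unfolding u by (simp add: power2_eq_square algebra_simps)
  moreover have "a * u\<^sup>2 + b * y\<^sup>2 = 2 \<or> a * u\<^sup>2 + b * y\<^sup>2 = - 2" using u(2) by linarith
  ultimately show "x\<^sup>2 + a * b * y\<^sup>2 = 2 * a \<or> x\<^sup>2 + a * b * y\<^sup>2 = - (2 * a)" by auto
qed

theorem proposition5p7:
  fixes m n d k :: int
    and rm rn rk \<gamma>1 \<gamma>2 \<gamma>3 \<gamma>4 :: complex
    and L OL :: "complex set"
    and H1 H2 H3 A1 A2 A3 :: "(complex \<Rightarrow> complex) set"
  assumes "squarefree m" and "squarefree n"
    and "[m = 1] (mod 4)" and "[n = 1] (mod 4)"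
    and "d = gcd m n" and "k = m * n div d\<^sup>2"
    and "rm\<^sup>2 = of_int m" and "rn\<^sup>2 = of_int n" and "rk = rm * rn / of_int d"
    and "L = rat_adjoin {rm, rn}" and "biquadratic L"
    and "OL = ring_of_integers L"
    and "nonclassical_HG L rm H1" and "nonclassical_HG L rn H2" and "nonclassical_HG L rk H3"
    and "A1 = associated_order L H1" and "A2 = associated_order L H2" and "A3 = associated_order L H3"
    and "\<gamma>1 = 1" and "\<gamma>2 = (1 + rm) / 2" and "\<gamma>3 = (1 + rn) / 2"
    and "\<gamma>4 = ((1 + rm) / 2) * ((1 + rk) / 2)"
  shows
    "(free_of_rank_one A1 OL \<longleftrightarrow>
        (\<exists>x y :: int. x\<^sup>2 + m * y\<^sup>2 = 2 * d \<or> x\<^sup>2 + m * y\<^sup>2 = - (2 * d))) \<and>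
     (\<forall>x y :: int. x\<^sup>2 + m * y\<^sup>2 = 2 * d \<or> x\<^sup>2 + m * y\<^sup>2 = - (2 * d) \<longrightarrow>
        (let \<epsilon> = ((x - m * y) div (2 * d)) mod 2 in
         free_generator A1 OL
           (1 / 2 * (of_int (m * y - x) / of_int (2 * d) - of_int \<epsilon>) * \<gamma>1
            + of_int (1 - y) / 2 * \<gamma>2
            + of_int (x - m * y) / of_int (2 * d) * \<gamma>3
            + of_int y * \<gamma>4))) \<and>
     (free_of_rank_one A2 OL \<longleftrightarrow>
        (\<exists>x y :: int. x\<^sup>2 + n * y\<^sup>2 = 2 * d \<or> x\<^sup>2 + n * y\<^sup>2 = - (2 * d))) \<and>
     (\<forall>x y :: int. x\<^sup>2 + n * y\<^sup>2 = 2 * d \<or> x\<^sup>2 + n * y\<^sup>2 = - (2 * d) \<longrightarrow>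
        (let \<epsilon> = ((m * y - x) div d) mod 4 in
         free_generator A2 OL
           (1 / 4 * (of_int (m * y - x) / of_int d - of_int \<epsilon>) * \<gamma>1
            + of_int (x - y * d) / of_int (2 * d) * \<gamma>2
            + of_int (d - m * y) / of_int (2 * d) * \<gamma>3
            + of_int y * \<gamma>4))) \<and>
     (free_of_rank_one A3 OL \<longleftrightarrow>
        (\<exists>x y :: int. x\<^sup>2 + k * y\<^sup>2 = 2 * (n div d) \<or> x\<^sup>2 + k * y\<^sup>2 = - (2 * (n div d)))) \<and>
     (\<forall>x y :: int. x\<^sup>2 + k * y\<^sup>2 = 2 * (n div d) \<or> x\<^sup>2 + k * y\<^sup>2 = - (2 * (n div d)) \<longrightarrow>
        (\<exists>\<epsilon> \<in> {1, - 1 :: int}.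
           [\<epsilon> = - ((k - x) div (n div d) - y)] (mod 4) \<and>
           free_generator A3 OL
             (1 / 4 * (of_int (k - x) / of_int (n div d) - of_int y + of_int \<epsilon>) * \<gamma>1
              + of_int (y - 1) / 2 * \<gamma>2
              + of_int (x - k) / of_int (2 * (n div d)) * \<gamma>3
              + \<gamma>4)))"
proof -
  define m' n' where "m' = m div d" and "n' = n div d"
  have nz: "m \<noteq> 0" "n \<noteq> 0" using assms(3,4) by (auto simp: cong_def)
  hence "d > 0" using assms(5) by auto
  have m: "m = d * m'" and n: "n = d * n'" using assms(5) by (auto simp: m'_def n'_def)
  have "k = (n' * m') * d\<^sup>2 div d\<^sup>2" unfolding assms(6) m n by (simp add: power2_eq_square ac_simps)
  hence k: "k = n' * m'" using \<open>d > 0\<close> by simp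
  have sqf: "squarefree d" "squarefree n'"
    using assms(1,2) squarefree_multD unfolding m n by blast+
  have "n' \<noteq> 0" using sqf by auto
  obtain e where K1: "klein n' m' d e rm rn rk L"
    using klein_biquadratic[OF assms(1-5,7-11)] unfolding m'_def n'_def by blast
  interpret K1: klein n' m' d e rm rn rk L by (rule K1)
  interpret K2: klein m' d n' e rn rk rm L by (rule K1.klein_rotate)
  interpret K3: klein d n' m' e rk rm rn L by (rule K2.klein_rotate)
  note A = assms(16-18) assms(12)
  have g4: "\<gamma>4 = (1 + rm + of_int m' * rn + rk) / 4"
    using K1.r_mult(3) unfolding assms(22) by (simp add: field_simps)
  note form1 = square_add_eq_iff_form[OF sqf(1), of _ m', folded m]
  note form2 = square_add_eq_iff_form[OF sqf(1), of _ n', folded n]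
  note form3 = square_add_eq_iff_form[OF sqf(2), of _ m', folded k]
  have odd: "odd d" "odd m'" "odd n'" using K1.odd_c by auto
  note lat_iff = lat_alt[OF K1.e K1.c_cong(2)]

  have "free_of_rank_one A1 OL \<longleftrightarrow> (\<exists>u y. \<bar>d * u\<^sup>2 + m' * y\<^sup>2\<bar> = 2)"
    unfolding A K1.free_of_rank_one_iff[OF assms(13)] ..
  also have "\<dots> \<longleftrightarrow> (\<exists>x y :: int. x\<^sup>2 + m * y\<^sup>2 = 2 * d \<or> x\<^sup>2 + m * y\<^sup>2 = - (2 * d))"
    unfolding form1 by blast
  finally have free1: "free_of_rank_one A1 OL \<longleftrightarrow>
    (\<exists>x y :: int. x\<^sup>2 + m * y\<^sup>2 = 2 * d \<or> x\<^sup>2 + m * y\<^sup>2 = - (2 * d))" .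

  have "free_of_rank_one A2 OL \<longleftrightarrow> (\<exists>y u. \<bar>n' * y\<^sup>2 + d * u\<^sup>2\<bar> = 2)"
    unfolding A K2.free_of_rank_one_iff[OF assms(14)] ..
  also have "\<dots> \<longleftrightarrow> (\<exists>x y :: int. x\<^sup>2 + n * y\<^sup>2 = 2 * d \<or> x\<^sup>2 + n * y\<^sup>2 = - (2 * d))"
    \<comment> \<open>In the rotated cases it is c2, not c3, that divides x, so the summands of the
      form appear in the opposite order.\<close>
    unfolding form2 by (subst add.commute) blast
  finally have free2: "free_of_rank_one A2 OL \<longleftrightarrow>
    (\<exists>x y :: int. x\<^sup>2 + n * y\<^sup>2 = 2 * d \<or> x\<^sup>2 + n * y\<^sup>2 = - (2 * d))" .

  have "free_of_rank_one A3 OL \<longleftrightarrow> (\<exists>y u. \<bar>m' * y\<^sup>2 + n' * u\<^sup>2\<bar> = 2)"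
    unfolding A K3.free_of_rank_one_iff[OF assms(15)] ..
  also have "\<dots> \<longleftrightarrow> (\<exists>x y :: int. x\<^sup>2 + k * y\<^sup>2 = 2 * n' \<or> x\<^sup>2 + k * y\<^sup>2 = - (2 * n'))"
    unfolding form3 by (subst add.commute) blast
  finally have free3: "free_of_rank_one A3 OL \<longleftrightarrow>
    (\<exists>x y :: int. x\<^sup>2 + k * y\<^sup>2 = 2 * n' \<or> x\<^sup>2 + k * y\<^sup>2 = - (2 * n'))" .

  have gen1: "let \<epsilon> = ((x - m * y) div (2 * d)) mod 2 in
         free_generator A1 OL
           (1 / 2 * (of_int (m * y - x) / of_int (2 * d) - of_int \<epsilon>) * \<gamma>1
            + of_int (1 - y) / 2 * \<gamma>2
            + of_int (x - m * y) / of_int (2 * d) * \<gamma>3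
            + of_int y * \<gamma>4)"
    if xy: "x\<^sup>2 + m * y\<^sup>2 = 2 * d \<or> x\<^sup>2 + m * y\<^sup>2 = - (2 * d)" for x y :: int
  proof -
    obtain u where x: "x = d * u" and u: "\<bar>d * u\<^sup>2 + m' * y\<^sup>2\<bar> = 2"
      using xy unfolding form1 by blast
    have o: "odd u \<and> odd y" by (rule odd_if_abs_form_eq_2[OF odd(1,2) u])
    hence "even (u - m' * y)" using odd by simp
    then obtain t where t: "u - m' * y = 2 * t" by blast
    have xt: "x - m * y = 2 * d * t" unfolding x m using t by (simp add: algebra_simps flip: distrib_left)
    \<comment> \<open>With coordinates (u0, 1, u, y) on 1, rm, rn, rk the lattice condition is 4 |
      u0 - 1 - 2 t. Its solution among +-1 is u0 = 1 - 2 (t mod 2).\<close>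
    define \<epsilon> where "\<epsilon> = t mod 2"
    have eps: "((x - m * y) div (2 * d)) mod 2 = \<epsilon>" unfolding xt \<epsilon>_def using \<open>d > 0\<close> by simp
    have "4 dvd 1 - 2 * \<epsilon> - 1 - 2 * t" unfolding \<epsilon>_def by presburger
    moreover have "1 - 2 * \<epsilon> - 1 - 2 * t = (1 - 2 * \<epsilon>) - 1 - u + m' * y" using t by simp
    ultimately have "4 dvd (1 - 2 * \<epsilon>) - 1 - u + m' * y" by (simp only:)
    hence "lat e (1 - 2 * \<epsilon>) 1 u y" unfolding lat_iff using o by auto
    moreover have "\<bar>1 - 2 * \<epsilon>\<bar> = 1" unfolding \<epsilon>_def by presburger
    ultimately have "free_generator A1 OL (K1.Q (1 - 2 * \<epsilon>) 1 u y)"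
      unfolding A K1.free_generator_iff[OF assms(13)] using u by (metis abs_one)
    also have q: "of_int (x - m * y) / of_int (2 * d) = (of_int t :: complex)"
      "of_int (m * y - x) / of_int (2 * d) = (- of_int t :: complex)"
      using xt \<open>d > 0\<close> by (simp_all add: field_simps)
    have "of_int u = (2 * of_int t + of_int m' * of_int y :: complex)"
      using t by (metis diff_add_cancel of_int_add of_int_mult of_int_numeral)
    hence "K1.Q (1 - 2 * \<epsilon>) 1 u y = 1 / 2 * (of_int (m * y - x) / of_int (2 * d) - of_int \<epsilon>) * \<gamma>1
            + of_int (1 - y) / 2 * \<gamma>2
            + of_int (x - m * y) / of_int (2 * d) * \<gamma>3
            + of_int y * \<gamma>4"
      unfolding q K1.Q_altdef g4 assms(19-21) by (simp add: field_simps)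
    finally show ?thesis unfolding eps Let_def .
  qed

  have gen2: "let \<epsilon> = ((m * y - x) div d) mod 4 in
         free_generator A2 OL
           (1 / 4 * (of_int (m * y - x) / of_int d - of_int \<epsilon>) * \<gamma>1
            + of_int (x - y * d) / of_int (2 * d) * \<gamma>2
            + of_int (d - m * y) / of_int (2 * d) * \<gamma>3
            + of_int y * \<gamma>4)"
    if xy: "x\<^sup>2 + n * y\<^sup>2 = 2 * d \<or> x\<^sup>2 + n * y\<^sup>2 = - (2 * d)" for x y :: int
  proof -
    obtain u where x: "x = d * u" and u: "\<bar>d * u\<^sup>2 + n' * y\<^sup>2\<bar> = 2"
      using xy unfolding form2 by blast
    have o: "odd u \<and> odd y" by (rule odd_if_abs_form_eq_2[OF odd(1,3) u])
    define t where "t = m' * y - u"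
    have "even t" unfolding t_def using o odd by simp
    have xt: "m * y - x = d * t" unfolding x m t_def by (simp add: algebra_simps)
    \<comment> \<open>The coordinates on 1, rm, rn, rk are (1 - \<epsilon>, u, 1, y), with lattice
      condition 4 | t - \<epsilon>. As t is even, \<epsilon> is 0 or 2 and the constant coordinate
      is +-1.\<close>
    define \<epsilon> where "\<epsilon> = t mod 4"
    have eps: "((m * y - x) div d) mod 4 = \<epsilon>" unfolding xt \<epsilon>_def using \<open>d > 0\<close> by simp
    have eps': "even \<epsilon>" "\<bar>1 - \<epsilon>\<bar> = 1" "4 dvd t - \<epsilon>" unfolding \<epsilon>_def using \<open>even t\<close> by presburger+
    have "t - \<epsilon> = (1 - \<epsilon>) - u - 1 + m' * y" by (simp add: t_def)
    with eps'(3) have "4 dvd (1 - \<epsilon>) - u - 1 + m' * y" by (simp only:)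
    with eps'(1) have "lat e (1 - \<epsilon>) u 1 y" unfolding lat_iff using o by auto
    hence "lat e (1 - \<epsilon>) 1 y u" by (simp add: lat_rotate[of e "1 - \<epsilon>" u])
    hence "free_generator A2 OL (K2.Q (1 - \<epsilon>) 1 y u)"
      unfolding A K2.free_generator_iff[OF assms(14)] using u eps'(2) by (metis abs_one add.commute)
    also have q: "of_int (m * y - x) / of_int d = (of_int t :: complex)"
      "of_int (x - y * d) / of_int (2 * d) = ((of_int u - of_int y) / 2 :: complex)"
      "of_int (d - m * y) / of_int (2 * d) = ((1 - of_int m' * of_int y) / 2 :: complex)"
      using \<open>d > 0\<close> unfolding xt unfolding x m by (simp_all add: field_simps)
    have "of_int t = (of_int m' * of_int y - of_int u :: complex)" by (simp add: t_def)
    hence "K2.Q (1 - \<epsilon>) 1 y u = 1 / 4 * (of_int (m * y - x) / of_int d - of_int \<epsilon>) * \<gamma>1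
            + of_int (x - y * d) / of_int (2 * d) * \<gamma>2
            + of_int (d - m * y) / of_int (2 * d) * \<gamma>3
            + of_int y * \<gamma>4"
      unfolding q K2.Q_altdef g4 assms(19-21) by (simp add: field_simps)
    finally show ?thesis unfolding eps Let_def .
  qed

  have gen3: "\<exists>\<epsilon> \<in> {1, - 1 :: int}.
           [\<epsilon> = - ((k - x) div n' - y)] (mod 4) \<and>
           free_generator A3 OL
             (1 / 4 * (of_int (k - x) / of_int n' - of_int y + of_int \<epsilon>) * \<gamma>1
              + of_int (y - 1) / 2 * \<gamma>2
              + of_int (x - k) / of_int (2 * n') * \<gamma>3
              + \<gamma>4)"
    if xy: "x\<^sup>2 + k * y\<^sup>2 = 2 * n' \<or> x\<^sup>2 + k * y\<^sup>2 = - (2 * n')" for x y :: int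
  proof -
    obtain u where x: "x = n' * u" and u: "\<bar>n' * u\<^sup>2 + m' * y\<^sup>2\<bar> = 2"
      using xy unfolding form3 by blast
    have o: "odd u \<and> odd y" by (rule odd_if_abs_form_eq_2[OF odd(3,2) u])
    have div: "(k - x) div n' = m' - u" using \<open>n' \<noteq> 0\<close> unfolding k x by (simp flip: right_diff_distrib)
    define t where "t = m' - u - y"
    have "odd t" unfolding t_def using o odd by simp
    \<comment> \<open>The coordinates on 1, rm, rn, rk are (\<epsilon>, y, u, 1), with lattice
      condition 4 | \<epsilon> + t. As t is odd, exactly one sign satisfies it.\<close>
    define \<epsilon> :: int where "\<epsilon> = (if t mod 4 = 3 then 1 else - 1)"
    have eps: "4 dvd \<epsilon> + t" "\<bar>\<epsilon>\<bar> = 1" "odd \<epsilon>" using \<open>odd t\<close> unfolding \<epsilon>_def by presburger+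
    have cong: "[\<epsilon> = - ((k - x) div n' - y)] (mod 4)"
      using eps(1) unfolding div t_def cong_iff_dvd_diff by (simp add: algebra_simps)
    have "\<epsilon> + t = \<epsilon> - y - u + m' * 1" by (simp add: t_def)
    with eps(1) have "4 dvd \<epsilon> - y - u + m' * 1" by (simp only:)
    hence "lat e \<epsilon> y u 1" unfolding lat_iff using o eps by auto
    hence "lat e \<epsilon> 1 y u" by (simp add: lat_rotate[of e \<epsilon> 1])
    hence "free_generator A3 OL (K3.Q \<epsilon> 1 y u)"
      unfolding A K3.free_generator_iff[OF assms(15)] using u eps(2) by (metis abs_one add.commute)
    also have q: "of_int (k - x) / of_int n' = (of_int m' - of_int u :: complex)"
      "of_int (x - k) / of_int (2 * n') = ((of_int u - of_int m') / 2 :: complex)"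
      using \<open>n' \<noteq> 0\<close> unfolding k x by (simp_all add: field_simps)
    have "K3.Q \<epsilon> 1 y u = 1 / 4 * (of_int (k - x) / of_int n' - of_int y + of_int \<epsilon>) * \<gamma>1
              + of_int (y - 1) / 2 * \<gamma>2
              + of_int (x - k) / of_int (2 * n') * \<gamma>3
              + \<gamma>4"
      unfolding q K3.Q_altdef g4 assms(19-21) by (simp add: field_simps)
    finally show ?thesis using cong eps(2) by (intro bexI[of _ \<epsilon>]) auto
  qed
  show ?thesis
    unfolding n'_def[symmetric] using free1 free2 free3 gen1 gen2 gen3 by blast
qed

end
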